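(* For any $\epsilon>0$, Algorithm CyclicTest$_\epsilon$ (with the implicit constants in $d_1,d_2,d_3$ suitably chosen) is an $\epsilon$-tester for the class of cyclic groups with respect to both the edit distance and the Hamming distance, when given the size $m=|\Gamma|$ and its prime factorization. Its query and time complexities are $O\big((\log m+\frac{\log\log m}{\epsilon})\cdot\log q\cdot\log\log\log m\big)$.
   Context: A magma $(\Gamma,\circ)$ is a finite set with a binary operation. Hamming distance: $\mathrm{Ham}_\Gamma(\circ,\ast)=|\{(x,y): x\circ y\neq x\ast y\}|$. Edit distance: a table of size $k$ is $T\colon\Pi\times\Pi\to\mathbb N$, $\Pi\subseteq\mathbb N$, $|\Pi|=k$; operations: exchange one value (cost $1$), insert a new index with $2k+1$ arbitrary new values (cost $2k+1$), delete an index (cost $2k-1$); the table edit distance is the minimum total cost. A multiplication table of $(\Gamma,\circ)$ is a table $T$ on $\Pi$ with $|\Pi|=|\Gamma|$ and a bijection $\sigma\colon\Pi\to\Gamma$ with $T(a,b)=\sigma^{-1}(\sigma(a)\circ\sigma(b))$; $\mathrm{edit}$ between magmas is the minimum table edit distance over their multiplication tables. $(\Gamma,\circ)$ is $\delta$-far from a class $\mathscr C$ of groups w.r.t. Hamming distance if $\mathrm{Ham}_\Gamma(\circ,\ast)\ge\delta|\Gamma|^2$ for every group $(\Gamma,\ast)$ in $\mathscr C$, and w.r.t. edit distance if $\mathrm{edit}((\Gamma,\circ),(\Gamma',\ast))\ge\delta|\Gamma|^2$ for every group $(\Gamma',\ast)\in\mathscr C$. Binary structure: $(q,O_1,O_2)$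 with $q\ge|\Gamma|$ and an injective $\pi\colon\Gamma\to\{0,1\}^{\lceil\log_2q\rceil}$; $O_1$ outputs $\pi(x)$ for uniformly random $x\in\Gamma$; $O_2(z_1,z_2)=\pi(\pi^{-1}(z_1)\circ\pi^{-1}(z_2))$ for $z_1,z_2\in\pi(\Gamma)$. An $\epsilon$-tester for $\mathscr C$ outputs PASS with probability $\ge 2/3$ on groups in $\mathscr C$ and FAIL with probability $\ge2/3$ on magmas $\epsilon$-far from $\mathscr C$. Algorithm CyclicTest$_\epsilon$. Input: a binary structure $(q,O_1,O_2)$ for $(\Gamma,\circ)$, the size $m=|\Gamma|$ and its factorization $m=p_1^{e_1}\cdots p_r^{e_r}$ into distinct primes. Let $C_m=\{0,\dots,m-1\}$ be the additive group of integers mod $m$ and $C_{m,i}=\{0,\frac m{p_i},\dots,(p_i-1)\frac m{p_i}\}$ its subgroup of order $p_i$. For $\gamma\in\Gamma$ define $f_\gamma\colon C_m\to\Gamma$ by $f_\gamma(1)=\gamma$; $f_\gamma(a)=\gamma\circ f_\gamma(a-1)$ if $2\le a\le m-1$ and $a$ odd; $f_\gamma(a)=f_\gamma(a/2)\circ f_\gamma(a/2)$ if $2\le a\le m-1$ and $a$ even; $f_\gamma(0)=\gamma\circ f_\gamma(m-1)$ (so $f_\gamma(a)$ is computable with $O(\log m)$ products). All operations in $\Gamma$ are done via $O_1,O_2$. Let $d_1=\Theta(\log\log m)$, $d_2=\Theta(\epsilon^{-1}\log\log\log m)$, $d_3=\Theta(\log\log\log m)$. The algorithm sets decision $\gets$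 FAIL, counter $\gets0$; while decision $=$ FAIL and counter $\le d_1$: set decision $\gets$ PASS; take $\gamma\in\Gamma$ uniformly at random; repeat $d_2$ times: take $x,y\in C_m$ uniformly at random and if $f_\gamma(x+y)\neq f_\gamma(x)\circ f_\gamma(y)$ set decision $\gets$ FAIL; for each $i\in\{1,\dots,r\}$: take two arbitrary distinct $x,y\in C_{m,i}$, take $d_3$ elements $u_1,\dots,u_{d_3}$ uniformly at random in $C_m$, and if $f_\gamma(x+u_j)=f_\gamma(y+u_j)$ for some $j$ set decision $\gets$ FAIL; then counter $\gets$ counter $+1$. Finally output decision. *)

theory Defs
  imports
    "HOL-Algebra.Elementary_Groups"
    "HOL-Probability.Probability_Mass_Function"
    "HOL-Computational_Algebra.Primes"
begin

section \<open>Magmas and cyclic groups\<close>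

text \<open>Magmas are nonempty here, because the first oracle of a binary structure samples from them.\<close>

definition magma :: "'a set \<Rightarrow> ('a \<Rightarrow> 'a \<Rightarrow> 'a) \<Rightarrow> bool" where
  "magma \<Gamma> f \<longleftrightarrow> finite \<Gamma> \<and> \<Gamma> \<noteq> {} \<and> (\<forall>x\<in>\<Gamma>. \<forall>y\<in>\<Gamma>. f x y \<in> \<Gamma>)"

definition is_cyclic_group :: "'a set \<Rightarrow> ('a \<Rightarrow> 'a \<Rightarrow> 'a) \<Rightarrow> bool" where
  "is_cyclic_group \<Gamma> f \<longleftrightarrow> finite \<Gamma> \<and>
     (\<exists>e. group \<lparr>carrier = \<Gamma>, monoid.mult = f, one = e\<rparr> \<and>
          cyclic_group \<lparr>carrier = \<Gamma>, monoid.mult = f, one = e\<rparr>)"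


section \<open>Hamming distance and edit distance\<close>

definition hamming :: "'a set \<Rightarrow> ('a \<Rightarrow> 'a \<Rightarrow> 'a) \<Rightarrow> ('a \<Rightarrow> 'a \<Rightarrow> 'a) \<Rightarrow> nat" where
  "hamming \<Gamma> f g = card {(x, y) \<in> \<Gamma> \<times> \<Gamma>. f x y \<noteq> g x y}"

text \<open>A table on the index set \<open>I\<close> is a partial map whose domain is exactly \<open>I \<times> I\<close>,
  so that equality of tables ignores everything outside \<open>I \<times> I\<close>.
  Entries are arbitrary naturals, not necessarily indices.\<close>

type_synonym table = "nat \<times> nat \<rightharpoonup> nat"

definition table_on :: "nat set \<Rightarrow> table \<Rightarrow> bool" where
  "table_on I T \<longleftrightarrow> finite I \<and> dom T = I \<times> I"

text \<open>\<open>table_edit S T c\<close>: some sequence of edit operations of total cost \<open>c\<close> turns \<open>S\<close> into \<open>T\<close>.\<close>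

inductive table_edit :: "table \<Rightarrow> table \<Rightarrow> nat \<Rightarrow> bool" where
  start: "table_edit S S 0"
| exchange: "table_edit S (T((a, b) \<mapsto> v)) (c + 1)"
    if "table_edit S T c" "table_on I T" "a \<in> I" "b \<in> I"
| insert: "table_edit S T' (c + (2 * card I + 1))"
    if "table_edit S T c" "table_on I T" "a \<notin> I"
       "table_on (insert a I) T'" "T' |` (I \<times> I) = T"
| delete: "table_edit S (T |` ((I - {a}) \<times> (I - {a}))) (c + (2 * card I - 1))"
    if "table_edit S T c" "table_on I T" "a \<in> I"

definition table_edit_distance :: "table \<Rightarrow> table \<Rightarrow> nat" where
  "table_edit_distance S T = (LEAST c. table_edit S T c)"

definition multiplication_table :: "'a set \<Rightarrow> ('a \<Rightarrow> 'a \<Rightarrow> 'a) \<Rightarrow> table \<Rightarrow> bool" where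
  "multiplication_table \<Gamma> f T \<longleftrightarrow>
     (\<exists>I \<sigma>. table_on I T \<and> bij_betw \<sigma> I \<Gamma> \<and>
        (\<forall>a\<in>I. \<forall>b\<in>I. T (a, b) = Some (inv_into I \<sigma> (f (\<sigma> a) (\<sigma> b)))))"

definition edit_distance ::
  "'a set \<Rightarrow> ('a \<Rightarrow> 'a \<Rightarrow> 'a) \<Rightarrow> 'b set \<Rightarrow> ('b \<Rightarrow> 'b \<Rightarrow> 'b) \<Rightarrow> nat" where
  "edit_distance \<Gamma> f \<Gamma>' g =
     (LEAST c. \<exists>S T. multiplication_table \<Gamma> f S \<and> multiplication_table \<Gamma>' g T \<and>
                     c = table_edit_distance S T)"

definition hamming_far ::
  "('a set \<Rightarrow> ('a \<Rightarrow> 'a \<Rightarrow> 'a) \<Rightarrow> bool) \<Rightarrow> real \<Rightarrow> 'a set \<Rightarrow> ('a \<Rightarrow> 'a \<Rightarrow> 'a) \<Rightarrow> bool" where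
  "hamming_far C \<delta> \<Gamma> f \<longleftrightarrow>
     (\<forall>g. C \<Gamma> g \<longrightarrow> real (hamming \<Gamma> f g) \<ge> \<delta> * real (card \<Gamma>) ^ 2)"

text \<open>The comparison groups range over all finite subsets of \<^typ>\<open>nat\<close>, so that every finite group
  is represented up to isomorphism whatever the element type \<^typ>\<open>'a\<close> is; the edit distance
  depends on its arguments only up to isomorphism.\<close>

definition edit_far ::
  "(nat set \<Rightarrow> (nat \<Rightarrow> nat \<Rightarrow> nat) \<Rightarrow> bool) \<Rightarrow> real \<Rightarrow> 'a set \<Rightarrow> ('a \<Rightarrow> 'a \<Rightarrow> 'a) \<Rightarrow> bool" where
  "edit_far C \<delta> \<Gamma> f \<longleftrightarrow>
     (\<forall>\<Gamma>' g. C \<Gamma>' g \<longrightarrow> real (edit_distance \<Gamma> f \<Gamma>' g) \<ge> \<delta> * real (card \<Gamma>) ^ 2)"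


section \<open>Binary structures and randomized oracle programs\<close>

type_synonym bits = "bool list"

text \<open>The second oracle is unconstrained outside the set of codewords.\<close>

definition binary_structure ::
  "'a set \<Rightarrow> ('a \<Rightarrow> 'a \<Rightarrow> 'a) \<Rightarrow> nat \<Rightarrow> bits pmf \<Rightarrow> (bits \<Rightarrow> bits \<Rightarrow> bits) \<Rightarrow> bool" where
  "binary_structure \<Gamma> f q O1 O2 \<longleftrightarrow> q \<ge> card \<Gamma> \<and>
     (\<exists>\<pi>. inj_on \<pi> \<Gamma> \<and> (\<forall>x\<in>\<Gamma>. length (\<pi> x) = nat \<lceil>log 2 (real q)\<rceil>) \<and>
          O1 = map_pmf \<pi> (pmf_of_set \<Gamma>) \<and>
          (\<forall>x\<in>\<Gamma>. \<forall>y\<in>\<Gamma>. O2 (\<pi> x) (\<pi> y) = \<pi> (f x y)))"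

text \<open>Randomized programs with access to the two oracles, in a unit-cost model whose words hold a
  codeword or an integer of \<open>O(log q)\<close> bits. \<open>Draw\<close> and \<open>Mul\<close> call the first and the second
  oracle (one query and one time unit each), \<open>Rand n\<close> draws a uniform element of
  \<open>{0, \<dots>, n - 1}\<close> (one time unit), and \<open>Tick n\<close> accounts for \<open>n\<close> elementary
  operations (arithmetic, comparison, assignment) on words.\<close>

datatype 'a prog =
    Return 'a
  | Draw "bits \<Rightarrow> 'a prog"
  | Mul bits bits "bits \<Rightarrow> 'a prog"
  | Rand nat "nat \<Rightarrow> 'a prog"
  | Tick nat "'a prog"

primrec bind_prog :: "'a prog \<Rightarrow> ('a \<Rightarrow> 'b prog) \<Rightarrow> 'b prog" where
  "bind_prog (Return v) h = h v"
| "bind_prog (Draw k) h = Draw (\<lambda>z. bind_prog (k z) h)"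
| "bind_prog (Mul z1 z2 k) h = Mul z1 z2 (\<lambda>z. bind_prog (k z) h)"
| "bind_prog (Rand n k) h = Rand n (\<lambda>a. bind_prog (k a) h)"
| "bind_prog (Tick n p) h = Tick n (bind_prog p h)"

adhoc_overloading Monad_Syntax.bind \<rightleftharpoons> bind_prog

definition charge :: "nat \<Rightarrow> nat \<Rightarrow> ('a \<times> nat \<times> nat) pmf \<Rightarrow> ('a \<times> nat \<times> nat) pmf" where
  "charge k t = map_pmf (\<lambda>(v, queries, time). (v, queries + k, time + t))"

text \<open>The joint distribution of the result, the number of queries and the running time.\<close>

primrec run ::
  "bits pmf \<Rightarrow> (bits \<Rightarrow> bits \<Rightarrow> bits) \<Rightarrow> 'a prog \<Rightarrow> ('a \<times> nat \<times> nat) pmf" where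
  "run O1 O2 (Return v) = return_pmf (v, 0, 0)"
| "run O1 O2 (Draw k) = charge 1 1 (bind_pmf O1 (\<lambda>z. run O1 O2 (k z)))"
| "run O1 O2 (Mul z1 z2 k) = charge 1 1 (run O1 O2 (k (O2 z1 z2)))"
| "run O1 O2 (Rand n k) = charge 0 1 (bind_pmf (pmf_of_set {..<n}) (\<lambda>a. run O1 O2 (k a)))"
| "run O1 O2 (Tick n p) = charge 0 n (run O1 O2 p)"

abbreviation "draw \<equiv> Draw Return"
abbreviation "mul z1 z2 \<equiv> Mul z1 z2 Return"
abbreviation "rand n \<equiv> Rand n Return"


section \<open>Testers that know the size and its factorization\<close>

datatype decision = PASS | FAIL

definition factorization :: "nat \<Rightarrow> (nat \<times> nat) list \<Rightarrow> bool" where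
  "factorization m fs \<longleftrightarrow> distinct (map fst fs) \<and> (\<forall>(p, e)\<in>set fs. prime p \<and> e > 0) \<and>
     m = (\<Prod>(p, e)\<leftarrow>fs. p ^ e)"

text \<open>An algorithm receives \<open>q\<close>, the size of the magma and the factorization of that size,
  and accesses the magma only through the oracles.\<close>

type_synonym algorithm = "nat \<Rightarrow> nat \<Rightarrow> (nat \<times> nat) list \<Rightarrow> decision prog"

definition tester ::
  "('a set \<Rightarrow> ('a \<Rightarrow> 'a \<Rightarrow> 'a) \<Rightarrow> bool) \<Rightarrow> ('a set \<Rightarrow> ('a \<Rightarrow> 'a \<Rightarrow> 'a) \<Rightarrow> bool) \<Rightarrow> algorithm \<Rightarrow> bool" where
  "tester C far A \<longleftrightarrow>
     (\<forall>\<Gamma> f q O1 O2 fs.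
        magma \<Gamma> f \<longrightarrow> binary_structure \<Gamma> f q O1 O2 \<longrightarrow> factorization (card \<Gamma>) fs \<longrightarrow>
        (C \<Gamma> f \<longrightarrow> pmf (map_pmf fst (run O1 O2 (A q (card \<Gamma>) fs))) PASS \<ge> 2 / 3) \<and>
        (far \<Gamma> f \<longrightarrow> pmf (map_pmf fst (run O1 O2 (A q (card \<Gamma>) fs))) FAIL \<ge> 2 / 3))"


section \<open>The algorithm\<close>

text \<open>\<open>pow_prog \<gamma> a\<close> evaluates the recursion for \<open>f\<^sub>\<gamma>(a)\<close> with \<open>1 \<le> a \<le> m - 1\<close>; in the even case the
  value at \<open>a / 2\<close> is computed once and multiplied with itself.\<close>

function pow_prog :: "bits \<Rightarrow> nat \<Rightarrow> bits prog" where
  "pow_prog \<gamma> a = Tick 3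
     (if a \<le> 1 then Return \<gamma>
      else if odd a then do { z \<leftarrow> pow_prog \<gamma> (a - 1); mul \<gamma> z }
      else do { z \<leftarrow> pow_prog \<gamma> (a div 2); mul z z })"
  by pat_completeness auto
termination by (relation "Wellfounded.measure snd") auto

declare pow_prog.simps [simp del]

text \<open>For \<open>m = 1\<close> we have \<open>0 = 1\<close> in \<open>C\<^sub>m\<close>, so \<open>f\<^sub>\<gamma>(0) = f\<^sub>\<gamma>(1) = \<gamma>\<close>; the equation
  \<open>f\<^sub>\<gamma>(0) = \<gamma> \<circ> f\<^sub>\<gamma>(m - 1)\<close> would be circular there.\<close>

definition f_prog :: "nat \<Rightarrow> bits \<Rightarrow> nat \<Rightarrow> bits prog" where
  "f_prog m \<gamma> a = Tick 3
     (if m = 1 then Return \<gamma>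
      else if a = 0 then do { z \<leftarrow> pow_prog \<gamma> (m - 1); mul \<gamma> z }
      else pow_prog \<gamma> a)"

definition hom_check :: "nat \<Rightarrow> bits \<Rightarrow> decision \<Rightarrow> decision prog" where
  "hom_check m \<gamma> dec = do {
     x \<leftarrow> rand m;
     y \<leftarrow> rand m;
     s \<leftarrow> Tick 2 (f_prog m \<gamma> ((x + y) mod m));
     a \<leftarrow> f_prog m \<gamma> x;
     b \<leftarrow> f_prog m \<gamma> y;
     ab \<leftarrow> mul a b;
     Tick 2 (Return (if s \<noteq> ab then FAIL else dec)) }"

definition inj_check :: "nat \<Rightarrow> bits \<Rightarrow> nat \<times> nat \<Rightarrow> decision \<Rightarrow> decision prog" where
  "inj_check m \<gamma> xy dec = do {
     u \<leftarrow> rand m;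
     a \<leftarrow> Tick 2 (f_prog m \<gamma> ((fst xy + u) mod m));
     b \<leftarrow> Tick 2 (f_prog m \<gamma> ((snd xy + u) mod m));
     Tick 2 (Return (if a = b then FAIL else dec)) }"

primrec repeat_prog :: "nat \<Rightarrow> ('s \<Rightarrow> 's prog) \<Rightarrow> 's \<Rightarrow> 's prog" where
  "repeat_prog 0 body s = Tick 1 (Return s)"
| "repeat_prog (Suc n) body s = Tick 2 (do { s' \<leftarrow> body s; repeat_prog n body s' })"

text \<open>\<open>pick p\<close> is the chosen pair of distinct elements of the subgroup of order \<open>p\<close>.\<close>

primrec prime_checks ::
  "(nat \<Rightarrow> nat \<times> nat) \<Rightarrow> nat \<Rightarrow> nat \<Rightarrow> bits \<Rightarrow> (nat \<times> nat) list \<Rightarrow> decision \<Rightarrow> decision prog" where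
  "prime_checks pick d3 m \<gamma> [] dec = Tick 1 (Return dec)"
| "prime_checks pick d3 m \<gamma> (pe # fs) dec = Tick 4 (do {
     dec' \<leftarrow> repeat_prog d3 (inj_check m \<gamma> (pick (fst pe))) dec;
     prime_checks pick d3 m \<gamma> fs dec' })"

function main_loop ::
  "(nat \<Rightarrow> nat \<Rightarrow> nat \<times> nat) \<Rightarrow> nat \<Rightarrow> nat \<Rightarrow> nat \<Rightarrow> nat \<Rightarrow> (nat \<times> nat) list \<Rightarrow>
   decision \<Rightarrow> nat \<Rightarrow> decision prog" where
  "main_loop pick d1 d2 d3 m fs dec counter = Tick 2
     (if dec = FAIL \<and> counter \<le> d1 then do {
        \<gamma> \<leftarrow> draw;
        dec1 \<leftarrow> Tick 1 (repeat_prog d2 (hom_check m \<gamma>) PASS);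
        dec2 \<leftarrow> prime_checks (pick counter) d3 m \<gamma> fs dec1;
        Tick 1 (main_loop pick d1 d2 d3 m fs dec2 (counter + 1)) }
      else Return dec)"
  by pat_completeness auto
termination
  by (relation "Wellfounded.measure (\<lambda>(pick, d1, d2, d3, m, fs, dec, counter). d1 + 1 - counter)") auto

declare main_loop.simps [simp del]

text \<open>\<open>lg x = ln x\<close> for \<open>x \<ge> e\<close>. The cut-off keeps the iterated logarithms defined and positive for
  small sizes, so that the algorithm makes sense for every \<open>m \<ge> 1\<close>.\<close>

definition lg :: "real \<Rightarrow> real" where
  "lg x = max 1 (ln x)"

text \<open>\<open>c1\<close>, \<open>c2\<close>, \<open>c3\<close> are the implicit constants in \<open>d\<^sub>1 = \<Theta>(log log m)\<close>,
  \<open>d\<^sub>2 = \<Theta>(\<epsilon>\<^sup>-\<^sup>1 log log log m)\<close> and \<open>d\<^sub>3 = \<Theta>(log log log m)\<close>. The arbitrary pairs are given by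
  \<open>pick m counter p\<close>, so they may change from one iteration of the main loop to the next.\<close>

definition cyclic_test ::
  "(nat \<Rightarrow> nat \<Rightarrow> nat \<Rightarrow> nat \<times> nat) \<Rightarrow> real \<Rightarrow> real \<Rightarrow> real \<Rightarrow> real \<Rightarrow> algorithm" where
  "cyclic_test pick c1 c2 c3 \<epsilon> q m fs =
     main_loop (pick m)
       (nat \<lceil>c1 * lg (lg (real m))\<rceil>)
       (nat \<lceil>c2 * lg (lg (lg (real m))) / \<epsilon>\<rceil>)
       (nat \<lceil>c3 * lg (lg (lg (real m)))\<rceil>)
       m fs FAIL 0"

definition prime_subgroup :: "nat \<Rightarrow> nat \<Rightarrow> nat set" where
  "prime_subgroup m p = {j * (m div p) | j. j < p}"

definition valid_pick :: "(nat \<Rightarrow> nat \<Rightarrow> nat \<Rightarrow> nat \<times> nat) \<Rightarrow> bool" where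
  "valid_pick pick \<longleftrightarrow>
     (\<forall>m counter p x y. m > 0 \<longrightarrow> prime p \<longrightarrow> p dvd m \<longrightarrow> pick m counter p = (x, y) \<longrightarrow>
        x \<in> prime_subgroup m p \<and> y \<in> prime_subgroup m p \<and> x \<noteq> y)"

end

theory Submission
  imports Defs "HOL-Algebra.Multiplicative_Group" "HOL-Number_Theory.Totient"
begin

text \<open>
  Completeness. On a cyclic group an iteration that draws a generator always passes. The proportion
  of generators is \<open>totient m / m\<close>, which is at least a constant times \<open>1 / log log m\<close> by an upper
  bound of Mertens type for the sum of \<open>1 / p\<close> over the primes \<open>p \<le> log m\<close>; the prime factors
  above \<open>log m\<close> are too few to matter. So \<open>\<Theta>(log log m)\<close> iterations suffice.

  Soundness. Fix \<open>\<gamma>\<close>, write \<open>F\<close> for \<open>f\<^sub>\<gamma>\<close> and let \<open>\<eta> < 1 / 16\<close> be the proportion of pairs at which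
  \<open>F\<close> is not multiplicative. If \<open>F u = F (u + k)\<close> holds for more than half of all \<open>u\<close>, then it holds
  for a proportion \<open>1 - 4 \<eta>\<close> of them, so the set of such \<open>k\<close> is a subgroup of \<open>C\<^sub>m\<close>. If this subgroup
  is nontrivial, it contains a subgroup of prime order, and the injectivity check for that prime
  fails with probability at least one half. If it is trivial, \<open>F\<close> is injective on the arguments \<open>x\<close>
  whose row \<open>{(x, y) | y}\<close> has less than \<open>m / 4\<close> failures, and extending this restriction to a
  bijection transports \<open>C\<^sub>m\<close> to a cyclic group on \<open>\<Gamma>\<close> at Hamming distance at most \<open>13 \<eta> m\<^sup>2\<close>. The edit
  distance is bounded by the Hamming distance, so one argument covers both.

  Complexity. The number of prime factors of \<open>m\<close> is \<open>O(log m / log log m)\<close>, which cancels the factor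
  \<open>log log m\<close> from the number of iterations.
\<close>

section \<open>Primes and the totient function\<close>

abbreviation primes_upto :: "nat \<Rightarrow> nat set" where
  "primes_upto n \<equiv> {p. prime p \<and> p \<le> n}"

lemma prod_dvd_of_pairwise_coprime:
  fixes g :: "'b \<Rightarrow> nat"
  assumes "finite A" "\<And>a. a \<in> A \<Longrightarrow> g a dvd N"
    and "\<And>a b. a \<in> A \<Longrightarrow> b \<in> A \<Longrightarrow> a \<noteq> b \<Longrightarrow> coprime (g a) (g b)"
  shows "(\<Prod>a\<in>A. g a) dvd N"
  using assms
proof (induction A rule: finite_induct)
  case (insert a A)
  have "coprime (g a) (\<Prod>a\<in>A. g a)"
    using insert by (intro prod_coprime_right) auto
  then show ?case
    using insert by (simp add: divides_mult)
qed simp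

text \<open>The two middle entries of the row are equal, so each is at most half of the row sum
  \<open>2 * 4 ^ k\<close>.\<close>

lemma binomial_odd_middle_le: "(2 * k + 1) choose k \<le> (4::nat) ^ k"
proof -
  have "((2 * k + 1) choose k) + ((2 * k + 1) choose (k + 1)) = (\<Sum>i\<in>{k, k + 1}. (2 * k + 1) choose i)"
    by simp
  also have "\<dots> \<le> (\<Sum>i\<le>2 * k + 1. (2 * k + 1) choose i)"
    by (intro sum_mono2) auto
  also have "\<dots> = 2 * 4 ^ k"
    by (subst choose_row_sum) (simp add: power_mult)
  also have "(2 * k + 1) choose (k + 1) = (2 * k + 1) choose k"
    by (subst binomial_symmetric) auto
  finally show ?thesis by simp
qed

text \<open>Erdos' induction. An even \<open>n > 2\<close> adds no prime. For
  \<open>n = 2 * k + 1\<close> the primes in \<open>{k + 2..n}\<close> divide \<open>n!\<close> but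
  neither \<open>k!\<close> nor \<open>(k + 1)!\<close>, hence they divide the middle binomial
  coefficient. The primes up to \<open>k + 1\<close> are covered by induction, and the exponents
  \<open>k + 1\<close> and \<open>k\<close> add up to \<open>n\<close>.\<close>

lemma primorial_le: "(\<Prod>p\<in>primes_upto n. p) \<le> (4::nat) ^ n"
proof (induction n rule: less_induct)
  case (less n)
  consider "n \<le> 1" | "n = 2" | "n > 2" "even n" | "n > 2" "odd n"
    by linarith
  then show ?case
  proof cases
    case 1
    then have "primes_upto n = {}"
      by (auto dest: prime_ge_2_nat)
    then have "(\<Prod>p\<in>primes_upto n. p) = 1" by (simp only: prod.empty)
    then show ?thesis by simp
  next
    case 2
    then have "primes_upto n = {2}"
      by (auto dest: prime_ge_2_nat)
    then show ?thesis using 2 by simp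
  next
    case 3
    then have "\<not> prime n"
      by (metis prime_odd_nat)
    then have eq: "primes_upto n = primes_upto (n - 1)"
      by (auto simp: le_less)
    have "(\<Prod>p\<in>primes_upto (n - 1). p) \<le> 4 ^ (n - 1)"
      using 3 by (intro less) simp
    also have "(4::nat) ^ (n - 1) \<le> 4 ^ n"
      by (intro power_increasing) auto
    finally show ?thesis unfolding eq .
  next
    case 4
    then obtain k where n: "n = 2 * k + 1" by (auto elim: oddE)
    define A where "A = {p. prime p \<and> k + 1 < p \<and> p \<le> n}"
    have fin: "finite A" "finite (primes_upto (k + 1))"
      unfolding A_def by auto
    have split: "primes_upto n = primes_upto (k + 1) \<union> A" "primes_upto (k + 1) \<inter> A = {}"
      using 4 n unfolding A_def by auto
    have "(\<Prod>p\<in>A. p) dvd ((2 * k + 1) choose k)"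
    proof (rule prod_dvd_of_pairwise_coprime[OF fin(1)])
      fix p assume "p \<in> A"
      then have p: "prime p" "k + 1 < p" "p \<le> 2 * k + 1"
        by (auto simp: A_def n)
      have "p dvd fact (2 * k + 1)"
        using p by (simp add: prime_dvd_fact_iff del: fact_Suc)
      also have "fact (2 * k + 1) = fact k * fact (k + 1) * ((2 * k + 1) choose k)"
        using binomial_fact_lemma[of k "2 * k + 1"] by (simp del: fact_Suc)
      finally show "p dvd ((2 * k + 1) choose k)"
        using p by (simp add: prime_dvd_mult_iff prime_dvd_fact_iff del: fact_Suc)
    qed (auto simp: A_def primes_coprime)
    then have "(\<Prod>p\<in>A. p) \<le> (2 * k + 1) choose k"
      by (intro dvd_imp_le) auto
    also have "\<dots> \<le> 4 ^ k" by (rule binomial_odd_middle_le)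
    finally have "(\<Prod>p\<in>primes_upto (k + 1). p) * (\<Prod>p\<in>A. p) \<le> 4 ^ (k + 1) * 4 ^ k"
      using less[of "k + 1"] 4 n by (intro mult_mono) auto
    then show ?thesis
      unfolding split(1) by (subst prod.union_disjoint[OF fin(2) fin(1) split(2)])
        (simp add: n power_add mult_2)
  qed
qed

section \<open>Upper bounds of Mertens type\<close>

lemma prime_power_dvd_fact:
  assumes "prime (p::nat)"
  shows "p ^ (n div p) dvd fact n"
proof (induction n)
  case (Suc n)
  show ?case
  proof (cases "p dvd Suc n")
    case True
    then have "Suc n div p = Suc (n div p)"
      by (simp add: div_Suc dvd_eq_mod_eq_0)
    then show ?thesis using mult_dvd_mono[OF True Suc] by (metis fact_Suc of_nat_id power_Suc)
  next
    case False
    then have "Suc n div p = n div p"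
      by (simp add: div_Suc dvd_eq_mod_eq_0)
    then show ?thesis using dvd_mult[OF Suc, of "Suc n"] by (metis fact_Suc of_nat_id)
  qed
qed simp

text \<open>Mertens' first theorem, upper bound: compare the logarithm of \<open>n!\<close> with the contribution
  of the multiples of each prime.\<close>

lemma sum_ln_prime_over_prime_le:
  assumes "n \<ge> 1"
  shows "(\<Sum>p\<in>primes_upto n. ln (real p) / real p) \<le> ln (real n) + ln 4"
proof -
  let ?P = "primes_upto n"
  have fin: "finite ?P" by auto
  have pos: "0 < real p" if "p \<in> ?P" for p using that prime_gt_0_nat by auto
  have "(\<Prod>p\<in>?P. p ^ (n div p)) dvd fact n"
    by (rule prod_dvd_of_pairwise_coprime) (auto simp: prime_power_dvd_fact primes_coprime)
  then have "(\<Prod>p\<in>?P. p ^ (n div p)) \<le> fact n"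
    by (rule dvd_imp_le) simp
  also have "\<dots> \<le> n ^ n"
    using fact_le_power[of n, where 'a = nat] by simp
  finally have "real (\<Prod>p\<in>?P. p ^ (n div p)) \<le> real (n ^ n)"
    by (rule of_nat_mono)
  then have le: "(\<Prod>p\<in>?P. real p ^ (n div p)) \<le> real n ^ n" by simp
  have "(\<Sum>p\<in>?P. real (n div p) * ln (real p)) = ln (\<Prod>p\<in>?P. real p ^ (n div p))"
    using pos by (subst ln_prod) (auto simp: ln_realpow fin)
  also have "\<dots> \<le> ln (real n ^ n)"
    using pos assms by (intro ln_mono le prod_pos) auto
  also have "\<dots> = real n * ln (real n)"
    using assms by (simp add: ln_realpow)
  finally have 1: "(\<Sum>p\<in>?P. real (n div p) * ln (real p)) \<le> real n * ln (real n)" .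
  \<comment> \<open>Replacing \<open>n / p\<close> by \<open>n div p\<close> loses at most
    \<open>ln p\<close> for each prime; the primorial bound limits the total loss to
    \<open>n * ln 4\<close>.\<close>
  have "real (\<Prod>p\<in>?P. p) \<le> real (4 ^ n)"
    by (intro of_nat_mono primorial_le)
  then have "(\<Prod>p\<in>?P. real p) \<le> 4 ^ n" by simp
  then have "ln (\<Prod>p\<in>?P. real p) \<le> ln (4 ^ n)"
    using pos by (intro ln_mono prod_pos) auto
  then have 2: "(\<Sum>p\<in>?P. ln (real p)) \<le> real n * ln 4"
    using pos by (subst (asm) ln_prod) (auto simp: ln_realpow fin)
  have "real n * (ln (real p) / real p) \<le> real (n div p) * ln (real p) + ln (real p)"
    if "p \<in> ?P" for p
  proof -
    have "n < p * (n div p + 1)"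
      using pos[OF that] by (simp add: dividend_less_times_div)
    then have "real n < real p * (real (n div p) + 1)"
      by (metis of_nat_1 of_nat_add of_nat_less_iff of_nat_mult)
    then have "real n / real p \<le> real (n div p) + 1"
      using pos[OF that] by (simp add: divide_le_eq mult.commute)
    moreover have "ln (real p) \<ge> 0" using pos[OF that] by simp
    ultimately have "real n / real p * ln (real p) \<le> (real (n div p) + 1) * ln (real p)"
      by (rule mult_right_mono)
    then show ?thesis by (simp add: algebra_simps)
  qed
  then have "real n * (\<Sum>p\<in>?P. ln (real p) / real p)
      \<le> (\<Sum>p\<in>?P. real (n div p) * ln (real p) + ln (real p))"
    unfolding sum_distrib_left by (intro sum_mono) auto
  also have "\<dots> \<le> real n * (ln (real n) + ln 4)"
    using 1 2 by (simp add: sum.distrib algebra_simps)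
  finally show ?thesis using assms by simp
qed

text \<open>The increment of \<open>ln (ln n)\<close> in the partial summation below. It comes from
  \<open>ln t \<le> t - 1\<close> at the ratio \<open>t\<close> of the two logarithms.\<close>

lemma one_minus_ratio_ln_le:
  assumes "k \<ge> 2"
  shows "1 - ln (real k) / ln (real (Suc k)) \<le> ln (ln (real (Suc k))) - ln (ln (real k))"
proof -
  have "ln (real k) > 0" "ln (real (Suc k)) > 0" using assms by auto
  then have "ln (ln (real k) / ln (real (Suc k))) \<le> ln (real k) / ln (real (Suc k)) - 1"
    by (intro ln_le_minus_one) simp
  then show ?thesis using \<open>ln (real k) > 0\<close> \<open>ln (real (Suc k)) > 0\<close>
    by (simp add: ln_div)
qed

text \<open>With this value the bound in the induction below is an equality at
  \<open>n = 2\<close>.\<close>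

definition mertens_const :: real where
  "mertens_const = 1 + ln 4 / ln 2 - ln (ln 2)"

text \<open>Mertens' second theorem, upper bound, by partial summation. The induction carries the
  remainder \<open>(ln n + ln 4 - A n) / ln n\<close> with \<open>A n\<close> the sum of \<open>ln p / p\<close>.\<close>

lemma sum_inverse_primes_aux:
  assumes "n \<ge> 2"
  shows "(\<Sum>p\<in>primes_upto n. 1 / real p)
    \<le> ln (ln (real n)) + mertens_const
      - (ln (real n) + ln 4 - (\<Sum>p\<in>primes_upto n. ln (real p) / real p)) / ln (real n)"
  using assms
proof (induction n rule: dec_induct)
  case base
  have "primes_upto 2 = {2}"
    by (auto dest: prime_ge_2_nat)
  then show ?case by (simp add: mertens_const_def field_simps)
next
  case (step n)
  let ?A = "\<lambda>n. \<Sum>p\<in>primes_upto n. ln (real p) / real p"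
  let ?S = "\<lambda>n. \<Sum>p\<in>primes_upto n. 1 / real p"
  let ?l = "ln (real n)" and ?l' = "ln (real (Suc n))"
  have l: "0 < ?l" "?l \<le> ?l'" using step by auto
  have eq: "?S (Suc n) - ?S n = (?A (Suc n) - ?A n) / ?l'"
  proof (cases "prime (Suc n)")
    case True
    then have "primes_upto (Suc n) = insert (Suc n) (primes_upto n)" by (auto simp: le_Suc_eq)
    moreover have "?l' \<noteq> 0" using l by linarith
    ultimately show ?thesis by (simp del: of_nat_Suc)
  next
    case False
    then have "primes_upto (Suc n) = primes_upto n" by (auto simp: le_Suc_eq)
    then show ?thesis by simp
  qed
  \<comment> \<open>By the first theorem the numerator of the remainder is nonnegative, so the
    remainder only grows when the denominator shrinks from \<open>?l'\<close> to
    \<open>?l\<close>.\<close>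
  have "?A n \<le> ?l + ln 4" using step by (intro sum_ln_prime_over_prime_le) auto
  then have "(?l + ln 4 - ?A n) / ?l' \<le> (?l + ln 4 - ?A n) / ?l"
    using l step by (intro divide_left_mono mult_pos_pos) (auto simp del: of_nat_Suc)
  moreover have "1 - ?l / ?l' \<le> ln ?l' - ln ?l"
    using step by (intro one_minus_ratio_ln_le) auto
  moreover have "(?l' + ln 4 - ?A (Suc n)) / ?l' = 1 + (ln 4 - ?A (Suc n)) / ?l'"
    using l step by (simp add: add_divide_distrib diff_divide_distrib del: of_nat_Suc)
  moreover have "(?l + ln 4 - ?A n) / ?l' = ?l / ?l' + (ln 4 - ?A n) / ?l'"
    by (simp add: add_divide_distrib diff_divide_distrib)
  moreover have "(?A (Suc n) - ?A n) / ?l' = (ln 4 - ?A n) / ?l' - (ln 4 - ?A (Suc n)) / ?l'"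
    by (simp add: diff_divide_distrib)
  ultimately show ?case using step.IH eq by linarith
qed

lemma sum_inverse_primes_le:
  assumes "n \<ge> 2"
  shows "(\<Sum>p\<in>primes_upto n. 1 / real p) \<le> ln (ln (real n)) + mertens_const"
proof -
  have "0 \<le> (ln (real n) + ln 4 - (\<Sum>p\<in>primes_upto n. ln (real p) / real p)) / ln (real n)"
    using assms sum_ln_prime_over_prime_le[of n] by (intro divide_nonneg_nonneg) auto
  then show ?thesis using sum_inverse_primes_aux[OF assms] by linarith
qed

section \<open>Prime factors of m and the lower bound for the totient\<close>

lemma sum_inverse_squares_le:
  "(\<Sum>k\<in>{2..n}. 1 / real k ^ 2) \<le> 1"
proof -
  \<comment> \<open>The sharper bound \<open>1 - 1 / n\<close> telescopes along the
    induction.\<close>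
  have *: "(\<Sum>k\<in>{2..n}. 1 / real k ^ 2) \<le> 1 - 1 / real n" if "n \<ge> 1"
    using that
  proof (induction n rule: dec_induct)
    case (step n)
    have "{2..Suc n} = insert (Suc n) {2..n}" using step by auto
    moreover have "1 / real (Suc n) ^ 2 \<le> 1 / real n - 1 / real (Suc n)"
    proof -
      have "1 / real n - 1 / real (Suc n) = 1 / (real n * real (Suc n))"
        using step by (simp add: field_simps)
      also have "\<dots> \<ge> 1 / real (Suc n) ^ 2"
        using step by (intro divide_left_mono) (auto simp: power2_eq_square)
      finally show ?thesis .
    qed
    ultimately show ?case using step by simp
  qed simp
  show ?thesis
  proof (cases "n \<ge> 1")
    case True
    have "1 - 1 / real n \<le> 1" by simp
    with *[OF True] show ?thesis by linarith
  qed simp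
qed

text \<open>The distinct prime factors above \<open>y\<close> multiply to a divisor of
  \<open>m\<close>; take logarithms.\<close>

lemma card_large_prime_factors:
  fixes y :: real
  assumes "m > 0" "y \<ge> 1"
  shows "real (card {p \<in> prime_factors m. real p > y}) * ln y \<le> ln (real m)"
proof -
  let ?B = "{p \<in> prime_factors m. real p > y}"
  have "(\<Prod>p\<in>?B. p) dvd m"
    by (rule prod_dvd_of_pairwise_coprime) (auto simp: primes_coprime in_prime_factors_iff)
  then have "(\<Prod>p\<in>?B. p) \<le> m" using assms by (intro dvd_imp_le) auto
  then have "real (\<Prod>p\<in>?B. p) \<le> real m" by (rule of_nat_mono)
  then have le: "(\<Prod>p\<in>?B. real p) \<le> real m" by simp
  have "real (card ?B) * ln y = (\<Sum>p\<in>?B. ln y)" by simp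
  also have "\<dots> \<le> (\<Sum>p\<in>?B. ln (real p))"
    using assms by (intro sum_mono) auto
  also have "\<dots> = ln (\<Prod>p\<in>?B. real p)"
    using assms by (subst ln_prod) auto
  also have "\<dots> \<le> ln (real m)"
    using assms le by (intro ln_mono prod_pos) auto
  finally show ?thesis .
qed

text \<open>Split at \<open>sqrt A\<close> for \<open>A = ln m\<close>. At most
  \<open>sqrt A\<close> prime factors lie below, and at most \<open>2 * A / ln A\<close> above,
  since \<open>ln (sqrt A) = ln A / 2\<close>. The first count is no larger than the second bound,
  by \<open>ln A \<le> 2 * sqrt A\<close>.\<close>

lemma card_prime_factors_le:
  assumes "m > 0" "ln (ln (real m)) > 0"
  shows "real (card (prime_factors m)) \<le> 4 * ln (real m) / ln (ln (real m))"
proof -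
  define A where "A = ln (real m)"
  have "A \<ge> 0" using assms(1) by (simp add: A_def)
  moreover have A0: "ln A > 0" using assms(2) by (simp add: A_def)
  \<comment> \<open>The default value \<open>ln 0 = 0\<close> excludes \<open>A = 0\<close>; then
    \<open>ln A > 0\<close> gives \<open>A > 1\<close>.\<close>
  ultimately have "A > 0" by (cases "A = 0") auto
  with A0 have A: "A > 1" "ln A > 0" by auto
  let ?B = "{p \<in> prime_factors m. real p > sqrt A}"
  let ?S = "{p \<in> prime_factors m. real p \<le> sqrt A}"
  have lnA: "ln (sqrt A) = ln A / 2" using A by (simp add: ln_sqrt)
  have "real (card ?B) * (ln A / 2) \<le> A"
    using card_large_prime_factors[of m "sqrt A"] assms A unfolding lnA A_def[symmetric] by simp
  then have B: "real (card ?B) \<le> 2 * A / ln A"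
    using A by (simp add: field_simps)
  have "?S \<subseteq> {1..nat \<lfloor>sqrt A\<rfloor>}"
    by (auto simp: in_prime_factors_iff le_nat_floor prime_ge_1_nat)
  then have "card ?S \<le> nat \<lfloor>sqrt A\<rfloor>"
    by (metis card_atLeastAtMost card_mono diff_Suc_1 finite_atLeastAtMost)
  then have S1: "real (card ?S) \<le> sqrt A"
    using A by (simp add: le_nat_iff le_floor_iff)
  have "ln A \<le> 2 * sqrt A"
    using lnA ln_le_minus_one[of "sqrt A"] A by simp
  then have "sqrt A * ln A \<le> 2 * A"
    using A mult_left_mono[of "ln A" "2 * sqrt A" "sqrt A"]
    by (simp add: mult.left_commute[of _ 2] del: mult_le_cancel_left_pos)
  then have "sqrt A \<le> 2 * A / ln A" using A by (simp add: field_simps)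
  moreover have "card (prime_factors m) \<le> card ?S + card ?B"
    by (rule order_trans[OF card_mono card_Un_le]) auto
  ultimately show ?thesis using B S1 unfolding A_def[symmetric] by linarith
qed

lemma ln_one_minus_ge:
  fixes x :: real
  assumes "0 \<le> x" "x \<le> 1 / 2"
  shows "ln (1 - x) \<ge> - 2 * x"
proof -
  have "x\<^sup>2 \<le> x / 2" using assms mult_left_mono[of x "1/2" x] by (simp add: power2_eq_square)
  then show ?thesis using ln_one_minus_pos_lower_bound[OF assms] by linarith
qed

text \<open>The 4 in the exponent is 2 for the quadratic error terms of the small prime factors plus
  2 for all large ones.\<close>

definition totient_const :: real where
  "totient_const = exp (- mertens_const - 4)"

lemma totient_const_pos: "totient_const > 0"
  by (simp add: totient_const_def)

text \<open>The ratio is the product of \<open>1 - 1 / p\<close> over the prime factors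
  \<open>p\<close>. In logarithms, the factors up to \<open>y\<close> cost at most the sum of
  \<open>1 / p\<close>, which Mertens' second theorem bounds, plus twice the sum of
  \<open>1 / p ^ 2\<close>. There are at most \<open>y\<close> factors above \<open>y\<close>, and
  each costs at most \<open>2 / y\<close>.\<close>

lemma totient_ratio_ge:
  assumes "m > 0"
  shows "real (totient m) / real m \<ge> totient_const / lg (lg (real m))"
proof -
  \<comment> \<open>The floor \<open>exp 1\<close> ensures \<open>ln y \<ge> 1\<close> and makes
    \<open>ln y\<close> equal to \<open>lg (lg m)\<close> for every \<open>m\<close>.\<close>
  define y where "y = max (exp 1) (ln (real m))"
  have y: "y \<ge> exp 1" "ln (real m) \<le> y" by (auto simp: y_def)
  have "exp 1 \<ge> (2::real)" using exp_ge_add_one_self[of 1] by simp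
  then have y2: "y \<ge> 2" using y by linarith
  have lny: "ln y \<ge> 1" using y by (metis exp_gt_zero ln_exp ln_mono)
  have lgy: "ln y = lg (lg (real m))"
  proof (cases "ln (real m) \<ge> exp 1")
    case True
    then have "ln (real m) \<ge> 2" using \<open>exp 1 \<ge> (2::real)\<close> by linarith
    then show ?thesis using True lny unfolding y_def lg_def by (simp add: max_def)
  next
    case False
    then have "ln (max 1 (ln (real m))) \<le> ln (exp 1)"
      using \<open>exp 1 \<ge> (2::real)\<close> by (intro ln_mono) auto
    then show ?thesis using False unfolding y_def lg_def by (simp add: max_def)
  qed
  let ?P = "prime_factors m"
  let ?B = "{p \<in> ?P. real p > y}" and ?S = "{p \<in> ?P. real p \<le> y}"
  define n where "n = nat \<lfloor>y\<rfloor>"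
  have n: "n \<ge> 2" "real n \<le> y" using y2 by (auto simp: n_def le_nat_iff le_floor_iff)
  have p2: "real p \<ge> 2" if "p \<in> ?P" for p
    using that prime_ge_2_nat by (auto simp: in_prime_factors_iff)
  have sub: "?S \<subseteq> primes_upto n"
    by (auto simp: n_def in_prime_factors_iff le_nat_floor)
  have "(\<Sum>p\<in>?S. 1 / real p) \<le> (\<Sum>p\<in>primes_upto n. 1 / real p)"
    by (rule sum_mono2[OF _ sub]) auto
  also have "\<dots> \<le> ln (ln (real n)) + mertens_const"
    by (rule sum_inverse_primes_le[OF n(1)])
  also have "ln (ln (real n)) \<le> ln (ln y)"
    using n y2 by (intro ln_mono) auto
  finally have S1: "(\<Sum>p\<in>?S. 1 / real p) \<le> ln (ln y) + mertens_const" by simp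
  have "(\<Sum>p\<in>?S. 1 / real p ^ 2) \<le> (\<Sum>p\<in>{2..n}. 1 / real p ^ 2)"
    using sub prime_ge_2_nat by (intro sum_mono2) auto
  then have S2: "(\<Sum>p\<in>?S. 1 / real p ^ 2) \<le> 1"
    using sum_inverse_squares_le[of n] by linarith
  have "- (\<Sum>p\<in>?S. 1 / real p) - 2 * (\<Sum>p\<in>?S. 1 / real p ^ 2)
      = (\<Sum>p\<in>?S. - (1 / real p) - 2 * (1 / real p)\<^sup>2)"
    by (simp add: sum_subtractf sum_negf sum_distrib_left power_divide)
  also have "\<dots> \<le> (\<Sum>p\<in>?S. ln (1 - 1 / real p))"
  proof (rule sum_mono)
    fix p assume "p \<in> ?S"
    then have "real p \<ge> 2" using p2 by auto
    then show "- (1 / real p) - 2 * (1 / real p)\<^sup>2 \<le> ln (1 - 1 / real p)"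
      by (intro ln_one_minus_pos_lower_bound) (auto simp: field_simps)
  qed
  finally have S: "(\<Sum>p\<in>?S. ln (1 - 1 / real p)) \<ge> - (ln (ln y) + mertens_const) - 2"
    using S1 S2 by linarith
  \<comment> \<open>The number of large prime factors times \<open>ln y\<close> is at most
    \<open>ln m \<le> y\<close>, and \<open>ln y \<ge> 1\<close>.\<close>
  have "real (card ?B) \<le> real (card ?B) * ln y"
    using mult_left_mono[OF lny, of "real (card ?B)"] by simp
  also have "\<dots> \<le> y" using card_large_prime_factors[of m y] assms y y2 by linarith
  finally have cB: "real (card ?B) \<le> y" .
  have "(\<Sum>p\<in>?B. - 2 / y) \<le> (\<Sum>p\<in>?B. ln (1 - 1 / real p))"
  proof (rule sum_mono)
    fix p assume p: "p \<in> ?B"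
    then have "real p \<ge> 2" "real p > y" using p2 by auto
    then have "ln (1 - 1 / real p) \<ge> - 2 * (1 / real p)"
      by (intro ln_one_minus_ge) (auto simp: field_simps)
    moreover have "1 / real p \<le> 1 / y" using \<open>real p > y\<close> y2 by (simp add: frac_le)
    ultimately show "- 2 / y \<le> ln (1 - 1 / real p)" by simp
  qed
  moreover have "(\<Sum>p\<in>?B. - 2 / y) \<ge> - 2"
    using cB y2 by (simp add: field_simps)
  ultimately have B: "(\<Sum>p\<in>?B. ln (1 - 1 / real p)) \<ge> - 2" by linarith
  have PU: "?P = ?S \<union> ?B" by auto
  have "(\<Sum>p\<in>?P. ln (1 - 1 / real p)) = (\<Sum>p\<in>?S. ln (1 - 1 / real p)) + (\<Sum>p\<in>?B. ln (1 - 1 / real p))"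
    by (subst PU, rule sum.union_disjoint) auto
  then have le: "- mertens_const - 4 - ln (ln y) \<le> (\<Sum>p\<in>?P. ln (1 - 1 / real p))"
    using S B by linarith
  have pos: "1 - 1 / real p > 0" if "p \<in> ?P" for p using p2[OF that] by (simp add: field_simps)
  have "totient_const / ln y = exp (- mertens_const - 4 - ln (ln y))"
    using lny by (simp add: totient_const_def exp_diff)
  also have "\<dots> \<le> exp (\<Sum>p\<in>?P. ln (1 - 1 / real p))" using le by simp
  also have "\<dots> = (\<Prod>p\<in>?P. 1 - 1 / real p)"
    using pos by (simp add: exp_sum)
  also have "\<dots> = real (totient m) / real m"
    using assms by (simp add: totient_formula2)
  finally show ?thesis unfolding lgy .
qed


section \<open>Outcome of the programs\<close>

definition result :: "bits pmf \<Rightarrow> (bits \<Rightarrow> bits \<Rightarrow> bits) \<Rightarrow> 'a prog \<Rightarrow> 'a pmf" where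
  "result O1 O2 p = map_pmf fst (run O1 O2 p)"

lemma map_fst_charge [simp]: "map_pmf fst (charge k t M) = map_pmf fst M"
  unfolding charge_def pmf.map_comp by (rule map_pmf_cong) auto

lemma result_simps [simp]:
  "result O1 O2 (Return v) = return_pmf v"
  "result O1 O2 (Draw k) = bind_pmf O1 (\<lambda>z. result O1 O2 (k z))"
  "result O1 O2 (Mul z1 z2 k) = result O1 O2 (k (O2 z1 z2))"
  "result O1 O2 (Rand n k') = bind_pmf (pmf_of_set {..<n}) (\<lambda>a. result O1 O2 (k' a))"
  "result O1 O2 (Tick n p) = result O1 O2 p"
  by (simp_all add: result_def map_bind_pmf)

lemma result_bind [simp]:
  "result O1 O2 (bind_prog p h) = bind_pmf (result O1 O2 p) (\<lambda>v. result O1 O2 (h v))"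
  by (induction p) (simp_all add: bind_return_pmf bind_assoc_pmf)

lemma UNIV_decision: "UNIV = {PASS, FAIL}"
  using decision.exhaust by auto

lemma pmf_bind_decision:
  fixes M :: "decision pmf"
  shows "pmf (bind_pmf M N) d = pmf M PASS * pmf (N PASS) d + pmf M FAIL * pmf (N FAIL) d"
proof -
  have "finite (UNIV :: decision set)" by (simp add: UNIV_decision)
  then have "pmf (bind_pmf M N) d = (\<Sum>a\<in>UNIV. pmf (N a) d * pmf M a)"
    unfolding pmf_bind by (rule integral_measure_pmf_real) simp
  then show ?thesis by (simp add: UNIV_decision mult.commute)
qed

lemma pmf_decision_sum: "pmf M PASS + pmf M FAIL = 1"
proof -
  have "(\<Sum>d\<in>UNIV. pmf M d) = 1"
    by (rule sum_pmf_eq_1) (simp add: UNIV_decision, simp)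
  then show ?thesis by (simp add: UNIV_decision)
qed

lemma result_repeat_FAIL:
  assumes "result O1 O2 (body FAIL) = return_pmf FAIL"
  shows "result O1 O2 (repeat_prog n body FAIL) = return_pmf FAIL"
  by (induction n) (simp_all add: assms bind_return_pmf)

text \<open>\<open>FAIL\<close> is absorbing, so passing means passing each of \<open>n\<close>
  independent repetitions.\<close>

lemma pass_repeat:
  assumes "result O1 O2 (body FAIL) = return_pmf FAIL"
  shows "pmf (result O1 O2 (repeat_prog n body PASS)) PASS = pmf (result O1 O2 (body PASS)) PASS ^ n"
  by (induction n) (simp_all add: pmf_bind_decision result_repeat_FAIL assms)

lemma result_prime_checks_FAIL:
  assumes "\<And>xy. result O1 O2 (inj_check m z xy FAIL) = return_pmf FAIL"
  shows "result O1 O2 (prime_checks pick d3 m z fs FAIL) = return_pmf FAIL"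
  by (induction fs) (simp_all add: assms bind_return_pmf result_repeat_FAIL)

lemma pass_prime_checks:
  assumes "\<And>xy. result O1 O2 (inj_check m z xy FAIL) = return_pmf FAIL"
  shows "pmf (result O1 O2 (prime_checks pick d3 m z fs PASS)) PASS
    = (\<Prod>pe\<leftarrow>fs. pmf (result O1 O2 (inj_check m z (pick (fst pe)) PASS)) PASS ^ d3)"
  by (induction fs)
     (simp_all add: pmf_bind_decision result_prime_checks_FAIL pass_repeat assms)

lemma pmf_map_pmf_of_set:
  assumes "finite S" "S \<noteq> {}"
  shows "pmf (map_pmf g (pmf_of_set S)) d = real (card {s \<in> S. g s = d}) / real (card S)"
proof -
  have "pmf (map_pmf g (pmf_of_set S)) d = measure (measure_pmf (pmf_of_set S)) (g -` {d})"
    by (simp add: pmf_map)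
  also have "\<dots> = real (card (S \<inter> g -` {d})) / real (card S)"
    using assms by (simp add: measure_pmf_of_set)
  also have "S \<inter> g -` {d} = {s \<in> S. g s = d}" by auto
  finally show ?thesis .
qed

lemma pmf_flag_PASS:
  assumes "finite S" "S \<noteq> {}"
  shows "pmf (map_pmf (\<lambda>s. if B s then FAIL else PASS) (pmf_of_set S)) PASS
    = 1 - real (card {s \<in> S. B s}) / real (card S)"
proof -
  have "card S = card {s \<in> S. \<not> B s} + card {s \<in> S. B s}"
    using assms by (subst card_Un_disjoint[symmetric]) (auto intro: arg_cong[where f = card])
  moreover have "{s \<in> S. (if B s then FAIL else PASS) = PASS} = {s \<in> S. \<not> B s}" by auto
  ultimately have "real (card {s \<in> S. (if B s then FAIL else PASS) = PASS})
      = real (card S) - real (card {s \<in> S. B s})"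
    by simp
  moreover have nz: "real (card S) \<noteq> 0" using assms by simp
  ultimately show ?thesis
    by (simp only: pmf_map_pmf_of_set[OF assms] diff_divide_distrib divide_self[OF nz])
qed

lemma prod_list_unit_interval:
  assumes "\<And>x. x \<in> set xs \<Longrightarrow> 0 \<le> g x \<and> g x \<le> (1::real)"
  shows "0 \<le> (\<Prod>x\<leftarrow>xs. g x) \<and> (\<Prod>x\<leftarrow>xs. g x) \<le> 1"
  using assms by (induction xs) (auto intro: mult_le_one)

lemma prod_list_le_member:
  assumes "\<And>x. x \<in> set xs \<Longrightarrow> 0 \<le> g x \<and> g x \<le> (1::real)" "x \<in> set xs"
  shows "(\<Prod>x\<leftarrow>xs. g x) \<le> g x"
  using assms
proof (induction xs)
  case (Cons a xs)
  have P: "0 \<le> (\<Prod>x\<leftarrow>xs. g x)" "(\<Prod>x\<leftarrow>xs. g x) \<le> 1" "0 \<le> g a" "g a \<le> 1"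
    using prod_list_unit_interval[of xs g] Cons.prems by auto
  show ?case
  proof (cases "x = a")
    case True
    then show ?thesis using P by (simp add: mult_left_le)
  next
    case False
    then have "(\<Prod>x\<leftarrow>xs. g x) \<le> g x" using Cons by auto
    then show ?thesis using P mult_left_le_one_le[of "\<Prod>x\<leftarrow>xs. g x" "g a"] by simp
  qed
qed simp

section \<open>Values of f_gamma in the magma and the probabilities of passing\<close>

function pow_val :: "('a \<Rightarrow> 'a \<Rightarrow> 'a) \<Rightarrow> 'a \<Rightarrow> nat \<Rightarrow> 'a" where
  "pow_val f \<gamma> a =
     (if a \<le> 1 then \<gamma>
      else if odd a then f \<gamma> (pow_val f \<gamma> (a - 1))
      else f (pow_val f \<gamma> (a div 2)) (pow_val f \<gamma> (a div 2)))"
  by pat_completeness auto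
termination by (relation "Wellfounded.measure (\<lambda>(f, \<gamma>, a). a)") auto

declare pow_val.simps [simp del]

definition f_val :: "('a \<Rightarrow> 'a \<Rightarrow> 'a) \<Rightarrow> nat \<Rightarrow> 'a \<Rightarrow> nat \<Rightarrow> 'a" where
  "f_val f m \<gamma> a =
     (if m = 1 then \<gamma> else if a = 0 then f \<gamma> (pow_val f \<gamma> (m - 1)) else pow_val f \<gamma> a)"

definition hom_failures :: "('a \<Rightarrow> 'a \<Rightarrow> 'a) \<Rightarrow> nat \<Rightarrow> (nat \<Rightarrow> 'a) \<Rightarrow> (nat \<times> nat) set" where
  "hom_failures f m F = {(x, y) \<in> {..<m} \<times> {..<m}. F ((x + y) mod m) \<noteq> f (F x) (F y)}"

definition collisions :: "nat \<Rightarrow> (nat \<Rightarrow> 'a) \<Rightarrow> nat \<Rightarrow> nat \<Rightarrow> nat set" where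
  "collisions m F x y = {u \<in> {..<m}. F ((x + u) mod m) = F ((y + u) mod m)}"

text \<open>\<open>\<pi>\<close> is an encoding whose existence \<open>binary_structure\<close>
  asserts; fixing it lets programs on codes be evaluated by \<open>f\<close> on
  \<open>\<Gamma>\<close>.\<close>

locale binary_oracle =
  fixes \<Gamma> :: "'a set" and f :: "'a \<Rightarrow> 'a \<Rightarrow> 'a"
    and O1 :: "bits pmf" and O2 :: "bits \<Rightarrow> bits \<Rightarrow> bits" and \<pi> :: "'a \<Rightarrow> bits" and m :: nat
  assumes magma: "magma \<Gamma> f"
    and inj: "inj_on \<pi> \<Gamma>"
    and O1: "O1 = map_pmf \<pi> (pmf_of_set \<Gamma>)"
    and O2: "\<And>x y. x \<in> \<Gamma> \<Longrightarrow> y \<in> \<Gamma> \<Longrightarrow> O2 (\<pi> x) (\<pi> y) = \<pi> (f x y)"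
    and card: "card \<Gamma> = m"
begin

lemma fin: "finite \<Gamma>" and ne: "\<Gamma> \<noteq> {}"
  and closed [simp]: "x \<in> \<Gamma> \<Longrightarrow> y \<in> \<Gamma> \<Longrightarrow> f x y \<in> \<Gamma>"
  using magma by (auto simp: magma_def)

lemma m_pos: "m > 0"
  using fin ne card by (auto simp: card_gt_0_iff)

lemma lessThan_m_ne: "{..<m} \<noteq> {}"
  using m_pos by auto

lemma pow_val_closed [simp]: "\<gamma> \<in> \<Gamma> \<Longrightarrow> pow_val f \<gamma> a \<in> \<Gamma>"
proof (induction a rule: less_induct)
  case (less a)
  then show ?case by (subst pow_val.simps) auto
qed

lemma f_val_closed [simp]: "\<gamma> \<in> \<Gamma> \<Longrightarrow> f_val f m \<gamma> a \<in> \<Gamma>"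
  by (simp add: f_val_def)

lemma result_pow_prog:
  "\<gamma> \<in> \<Gamma> \<Longrightarrow> result O1 O2 (pow_prog (\<pi> \<gamma>) a) = return_pmf (\<pi> (pow_val f \<gamma> a))"
proof (induction a rule: less_induct)
  case (less a)
  then show ?case
    by (subst pow_prog.simps, subst pow_val.simps) (auto simp: bind_return_pmf O2)
qed

lemma result_f_prog [simp]:
  "\<gamma> \<in> \<Gamma> \<Longrightarrow> result O1 O2 (f_prog m (\<pi> \<gamma>) a) = return_pmf (\<pi> (f_val f m \<gamma> a))"
  by (simp add: f_prog_def f_val_def result_pow_prog bind_return_pmf O2)

lemma code_eq_iff: "x \<in> \<Gamma> \<Longrightarrow> y \<in> \<Gamma> \<Longrightarrow> \<pi> x = \<pi> y \<longleftrightarrow> x = y"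
  using inj by (auto dest: inj_onD)

lemma result_hom_check:
  assumes "\<gamma> \<in> \<Gamma>"
  shows "result O1 O2 (hom_check m (\<pi> \<gamma>) dec) =
    map_pmf (\<lambda>(x, y). if (x, y) \<in> hom_failures f m (f_val f m \<gamma>) then FAIL else dec)
      (pmf_of_set ({..<m} \<times> {..<m}))"
proof -
  let ?F = "f_val f m \<gamma>" and ?U = "pmf_of_set {..<m}"
  have U: "set_pmf ?U = {..<m}" using lessThan_m_ne by simp
  have "result O1 O2 (hom_check m (\<pi> \<gamma>) dec) = bind_pmf ?U (\<lambda>x. bind_pmf ?U (\<lambda>y.
      return_pmf (if ?F ((x + y) mod m) \<noteq> f (?F x) (?F y) then FAIL else dec)))"
    using assms by (simp add: hom_check_def bind_return_pmf O2 code_eq_iff)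
  also have "\<dots> = bind_pmf ?U (\<lambda>x. bind_pmf ?U (\<lambda>y.
      return_pmf (if (x, y) \<in> hom_failures f m ?F then FAIL else dec)))"
    by (intro bind_pmf_cong refl) (auto simp: U hom_failures_def)
  also have "\<dots> = map_pmf (\<lambda>(x, y). if (x, y) \<in> hom_failures f m ?F then FAIL else dec) (pair_pmf ?U ?U)"
    by (simp add: pair_pmf_def map_bind_pmf)
  \<comment> \<open>Two independent uniform draws form a uniform pair.\<close>
  also have "pair_pmf ?U ?U = pmf_of_set ({..<m} \<times> {..<m})"
    using m_pos by (intro pmf_eqI) (auto simp: pmf_pair indicator_def lessThan_empty_iff)
  finally show ?thesis .
qed

lemma result_inj_check:
  assumes "\<gamma> \<in> \<Gamma>"
  shows "result O1 O2 (inj_check m (\<pi> \<gamma>) xy dec) =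
    map_pmf (\<lambda>u. if u \<in> collisions m (f_val f m \<gamma>) (fst xy) (snd xy) then FAIL else dec)
      (pmf_of_set {..<m})"
proof -
  let ?F = "f_val f m \<gamma>" and ?U = "pmf_of_set {..<m}"
  have U: "set_pmf ?U = {..<m}" using lessThan_m_ne by simp
  show ?thesis
    using assms unfolding map_pmf_def
    by (auto simp: inj_check_def bind_return_pmf code_eq_iff collisions_def U intro!: bind_pmf_cong)
qed

lemma result_hom_check_FAIL: "\<gamma> \<in> \<Gamma> \<Longrightarrow> result O1 O2 (hom_check m (\<pi> \<gamma>) FAIL) = return_pmf FAIL"
  by (simp add: result_hom_check split_def)

lemma result_inj_check_FAIL: "\<gamma> \<in> \<Gamma> \<Longrightarrow> result O1 O2 (inj_check m (\<pi> \<gamma>) xy FAIL) = return_pmf FAIL"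
  by (simp add: result_inj_check)

lemma pass_hom_check:
  assumes "\<gamma> \<in> \<Gamma>"
  shows "pmf (result O1 O2 (hom_check m (\<pi> \<gamma>) PASS)) PASS
    = 1 - real (card (hom_failures f m (f_val f m \<gamma>))) / real m ^ 2"
proof -
  let ?H = "hom_failures f m (f_val f m \<gamma>)"
  have "{s \<in> {..<m} \<times> {..<m}. s \<in> ?H} = ?H" by (auto simp: hom_failures_def)
  then show ?thesis
    using pmf_flag_PASS[of "{..<m} \<times> {..<m}" "\<lambda>s. s \<in> ?H"] m_pos
    by (auto simp: result_hom_check[OF assms] split_def power2_eq_square)
qed

lemma pass_inj_check:
  assumes "\<gamma> \<in> \<Gamma>"
  shows "pmf (result O1 O2 (inj_check m (\<pi> \<gamma>) xy PASS)) PASS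
    = 1 - real (card (collisions m (f_val f m \<gamma>) (fst xy) (snd xy))) / real m"
proof -
  let ?C = "collisions m (f_val f m \<gamma>) (fst xy) (snd xy)"
  have "{s \<in> {..<m}. s \<in> ?C} = ?C" by (auto simp: collisions_def)
  then show ?thesis
    using pmf_flag_PASS[of "{..<m}" "\<lambda>s. s \<in> ?C"] m_pos
    by (auto simp: result_inj_check[OF assms])
qed

text \<open>The probability that an iteration that has drawn \<open>\<gamma>\<close> ends in
  \<open>PASS\<close>. The checks use independent randomness, so their probabilities
  multiply.\<close>

definition iteration_pass :: "(nat \<Rightarrow> nat \<times> nat) \<Rightarrow> nat \<Rightarrow> nat \<Rightarrow> (nat \<times> nat) list \<Rightarrow> 'a \<Rightarrow> real" where
  "iteration_pass pick d2 d3 fs \<gamma> =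
     (1 - real (card (hom_failures f m (f_val f m \<gamma>))) / real m ^ 2) ^ d2 *
     (\<Prod>pe\<leftarrow>fs. (1 - real (card (collisions m (f_val f m \<gamma>) (fst (pick (fst pe))) (snd (pick (fst pe)))))
        / real m) ^ d3)"

text \<open>The loop outputs \<open>FAIL\<close> exactly if each iteration does, and the iterations
  are independent. The factors are indexed by the counter because the chosen pairs may depend on it.
  From counter 0 there are \<open>d1 + 1\<close> factors; at \<open>counter = d1 + 1\<close> the
  product is empty.\<close>

lemma fail_main_loop:
  assumes "counter \<le> d1 + 1"
  shows "pmf (result O1 O2 (main_loop pick d1 d2 d3 m fs FAIL counter)) FAIL
    = (\<Prod>c\<in>{counter..d1}. 1 - (\<Sum>\<gamma>\<in>\<Gamma>. iteration_pass (pick c) d2 d3 fs \<gamma>) / real m)"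
  using assms
proof (induction "d1 + 1 - counter" arbitrary: counter)
  case 0
  then show ?case by (subst main_loop.simps) simp
next
  case (Suc k)
  then have le: "counter \<le> d1" by simp
  let ?it = "\<lambda>z. bind_pmf (result O1 O2 (repeat_prog d2 (hom_check m z) PASS))
    (\<lambda>dec. result O1 O2 (prime_checks (pick counter) d3 m z fs dec))"
  let ?I = "bind_pmf O1 ?it"
  have PASS: "result O1 O2 (main_loop pick d1 d2 d3 m fs PASS (counter + 1)) = return_pmf PASS"
    by (subst main_loop.simps) simp
  have "result O1 O2 (main_loop pick d1 d2 d3 m fs FAIL counter)
      = bind_pmf ?I (\<lambda>dec. result O1 O2 (main_loop pick d1 d2 d3 m fs dec (counter + 1)))"
    using le by (subst main_loop.simps) (simp add: bind_assoc_pmf)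
  then have "pmf (result O1 O2 (main_loop pick d1 d2 d3 m fs FAIL counter)) FAIL
      = pmf ?I FAIL * pmf (result O1 O2 (main_loop pick d1 d2 d3 m fs FAIL (counter + 1))) FAIL"
    by (simp only: pmf_bind_decision PASS) simp
  moreover have "pmf ?I FAIL = 1 - (\<Sum>\<gamma>\<in>\<Gamma>. iteration_pass (pick counter) d2 d3 fs \<gamma>) / real m"
  proof -
    have "?I = bind_pmf (pmf_of_set \<Gamma>) (\<lambda>\<gamma>. ?it (\<pi> \<gamma>))"
      by (simp add: O1 bind_map_pmf)
    then have "pmf ?I PASS = (\<Sum>\<gamma>\<in>\<Gamma>. pmf (?it (\<pi> \<gamma>)) PASS) / real m"
      using fin ne by (simp add: pmf_bind integral_pmf_of_set card)
    also have "(\<Sum>\<gamma>\<in>\<Gamma>. pmf (?it (\<pi> \<gamma>)) PASS) = (\<Sum>\<gamma>\<in>\<Gamma>. iteration_pass (pick counter) d2 d3 fs \<gamma>)"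
      by (intro sum.cong refl) (simp add: pmf_bind_decision pass_repeat pass_prime_checks
        result_prime_checks_FAIL result_hom_check_FAIL result_inj_check_FAIL pass_hom_check
        pass_inj_check iteration_pass_def)
    finally show ?thesis using pmf_decision_sum[of ?I] by linarith
  qed
  moreover have "{counter..d1} = insert counter {counter + 1..d1}" using le by auto
  ultimately show ?case using Suc.hyps(1)[of "counter + 1"] Suc.hyps(2) le by simp
qed

lemma card_hom_failures_le: "real (card (hom_failures f m F)) / real m ^ 2 \<le> 1"
proof -
  have "card (hom_failures f m F) \<le> card ({..<m} \<times> {..<m})"
    by (rule card_mono) (auto simp: hom_failures_def)
  then have "real (card (hom_failures f m F)) \<le> real m ^ 2"
    by (simp add: power2_eq_square flip: of_nat_mult)
  then show ?thesis using m_pos by simp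
qed

lemma card_collisions_le: "real (card (collisions m F x y)) / real m \<le> 1"
proof -
  have "card (collisions m F x y) \<le> card {..<m}"
    by (rule card_mono) (auto simp: collisions_def)
  then show ?thesis using m_pos by simp
qed

lemma iteration_pass_le_hom:
  "iteration_pass pick d2 d3 fs \<gamma>
    \<le> (1 - real (card (hom_failures f m (f_val f m \<gamma>))) / real m ^ 2) ^ d2"
  unfolding iteration_pass_def
  using card_hom_failures_le card_collisions_le
  by (intro mult_left_le conjunct2[OF prod_list_unit_interval] zero_le_power conjI power_le_one) auto

lemma iteration_pass_le_inj:
  assumes "pe \<in> set fs"
  shows "iteration_pass pick d2 d3 fs \<gamma>
    \<le> (1 - real (card (collisions m (f_val f m \<gamma>) (fst (pick (fst pe))) (snd (pick (fst pe)))))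
        / real m) ^ d3"
proof -
  let ?g = "\<lambda>pe. (1 - real (card (collisions m (f_val f m \<gamma>) (fst (pick (fst pe))) (snd (pick (fst pe)))))
        / real m) ^ d3"
  have g: "0 \<le> ?g pe \<and> ?g pe \<le> 1" for pe
    using card_collisions_le by (intro conjI zero_le_power power_le_one) auto
  have "0 \<le> (1 - real (card (hom_failures f m (f_val f m \<gamma>))) / real m ^ 2) ^ d2"
    "(1 - real (card (hom_failures f m (f_val f m \<gamma>))) / real m ^ 2) ^ d2 \<le> 1"
    using card_hom_failures_le by (auto intro!: zero_le_power power_le_one)
  then have "iteration_pass pick d2 d3 fs \<gamma> \<le> (\<Prod>pe\<leftarrow>fs. ?g pe)"
    unfolding iteration_pass_def
    using prod_list_unit_interval[of fs ?g] g by (intro mult_left_le_one_le) auto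
  also have "\<dots> \<le> ?g pe"
    using g assms by (intro prod_list_le_member) auto
  finally show ?thesis .
qed

lemma iteration_pass_nonneg: "0 \<le> iteration_pass pick d2 d3 fs \<gamma>"
  unfolding iteration_pass_def
  using card_hom_failures_le card_collisions_le
  by (intro mult_nonneg_nonneg conjunct1[OF prod_list_unit_interval] zero_le_power conjI power_le_one) auto

lemma iteration_pass_le_1: "iteration_pass pick d2 d3 fs \<gamma> \<le> 1"
  by (rule order_trans[OF iteration_pass_le_hom])
     (use card_hom_failures_le in \<open>auto intro!: power_le_one\<close>)

end


section \<open>Near-homomorphisms from a cyclic group to a magma\<close>

definition bad_row :: "('a \<Rightarrow> 'a \<Rightarrow> 'a) \<Rightarrow> nat \<Rightarrow> (nat \<Rightarrow> 'a) \<Rightarrow> nat \<Rightarrow> nat set" where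
  "bad_row f m F x = {y \<in> {..<m}. F ((x + y) mod m) \<noteq> f (F x) (F y)}"

text \<open>If \<open>F\<close> is a homomorphism to a group, this is everything or empty according
  to whether \<open>k\<close> lies in the kernel. Majority periods play the part of the kernel for a
  near-homomorphism.\<close>

definition periods :: "nat \<Rightarrow> (nat \<Rightarrow> 'a) \<Rightarrow> nat \<Rightarrow> nat set" where
  "periods m F k = {u \<in> {..<m}. F u = F ((u + k) mod m)}"

lemma finite_hom_failures: "finite (hom_failures f m F)"
  by (rule finite_subset[of _ "{..<m} \<times> {..<m}"]) (auto simp: hom_failures_def)

context
  fixes m :: nat
  assumes m_pos: "m > 0"
begin

lemma inj_on_shift: "inj_on (\<lambda>u. (x + u) mod m) {..<m}"
proof (rule inj_onI)
  fix u v assume "u \<in> {..<m}" "v \<in> {..<m}" "(x + u) mod m = (x + v) mod m"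
  then have "[u = v] (mod m)" using cong_add_lcancel_nat[of x u v m] by (simp add: cong_def)
  with \<open>u \<in> _\<close> \<open>v \<in> _\<close> show "u = v" by (simp add: cong_def)
qed

lemma image_shift: "(\<lambda>u. (x + u) mod m) ` {..<m} = {..<m}"
  by (rule endo_inj_surj) (use m_pos inj_on_shift in auto)

lemma card_shift: "card {u \<in> {..<m}. P ((x + u) mod m)} = card {u \<in> {..<m}. P u}"
proof -
  let ?s = "\<lambda>u. (x + u) mod m"
  have "{u \<in> ?s ` {..<m}. P u} = ?s ` {u \<in> {..<m}. P (?s u)}" by auto
  then have "{u \<in> {..<m}. P u} = ?s ` {u \<in> {..<m}. P (?s u)}" by (simp only: image_shift)
  moreover have "inj_on ?s {u \<in> {..<m}. P (?s u)}"
    by (rule inj_on_subset[OF inj_on_shift]) auto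
  ultimately show ?thesis by (simp add: card_image)
qed

lemma card_hom_failures: "card (hom_failures f m F) = (\<Sum>x<m. card (bad_row f m F x))"
proof -
  have "hom_failures f m F = Sigma {..<m} (bad_row f m F)"
    by (auto simp: hom_failures_def bad_row_def)
  then show ?thesis by (simp add: bad_row_def)
qed

text \<open>A single coincidence \<open>F x = F (x + k)\<close> propagates to almost all arguments, since
  \<open>F (x + y) = f (F x) (F y) = f (F (x + k)) (F y) = F (x + k + y)\<close> for most \<open>y\<close>.\<close>

lemma coincidence_propagates:
  assumes "F x = F ((x + k) mod m)"
  shows "m \<le> card (bad_row f m F x) + card (bad_row f m F ((x + k) mod m)) + card (periods m F k)"
proof -
  let ?P = "{y \<in> {..<m}. (x + y) mod m \<in> periods m F k}"
  have "{..<m} \<subseteq> bad_row f m F x \<union> bad_row f m F ((x + k) mod m) \<union> ?P"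
  proof
    fix y assume y: "y \<in> {..<m}"
    have "((x + k) mod m + y) mod m = ((x + y) mod m + k) mod m"
      by (simp add: mod_simps add.commute add.left_commute)
    then show "y \<in> bad_row f m F x \<union> bad_row f m F ((x + k) mod m) \<union> ?P"
      using y assms m_pos by (auto simp: bad_row_def periods_def)
  qed
  then have "card {..<m} \<le> card (bad_row f m F x \<union> bad_row f m F ((x + k) mod m) \<union> ?P)"
    by (rule card_mono[rotated]) (auto simp: bad_row_def)
  also have "\<dots> \<le> card (bad_row f m F x) + card (bad_row f m F ((x + k) mod m)) + card ?P"
    by (meson card_Un_le order_trans add_right_mono)
  also have "card ?P = card {u \<in> {..<m}. u \<in> periods m F k}" by (rule card_shift)
  also have "{u \<in> {..<m}. u \<in> periods m F k} = periods m F k" by (auto simp: periods_def)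
  finally show ?thesis by simp
qed

lemma sum_bad_row_shift: "(\<Sum>x<m. card (bad_row f m F ((x + k) mod m))) = card (hom_failures f m F)"
proof -
  have "(\<Sum>x<m. card (bad_row f m F ((x + k) mod m)))
      = (\<Sum>x\<in>(\<lambda>u. (k + u) mod m) ` {..<m}. card (bad_row f m F x))"
    by (subst sum.reindex[OF inj_on_shift]) (simp add: add.commute)
  then show ?thesis by (simp add: image_shift card_hom_failures)
qed

lemma card_periods_le: "card (periods m F k) \<le> m"
  using card_mono[of "{..<m}" "periods m F k"] by (auto simp: periods_def)

text \<open>Double counting. Each \<open>x\<close> in \<open>periods m F k\<close> forces
  \<open>m - card (periods m F k)\<close> failures in the rows \<open>x\<close> and
  \<open>x + k\<close> together, each row is used at most twice, and there are more than
  \<open>m / 2\<close> such \<open>x\<close>.\<close>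

lemma majority_periods_gap:
  assumes "m < 2 * card (periods m F k)"
  shows "m * (m - card (periods m F k)) \<le> 4 * card (hom_failures f m F)"
proof -
  let ?A = "periods m F k"
  have sub: "?A \<subseteq> {..<m}" by (auto simp: periods_def)
  have "card ?A * (m - card ?A) = (\<Sum>x\<in>?A. m - card ?A)" by simp
  also have "\<dots> \<le> (\<Sum>x\<in>?A. card (bad_row f m F x) + card (bad_row f m F ((x + k) mod m)))"
  proof (rule sum_mono)
    fix x assume "x \<in> ?A"
    then have "F x = F ((x + k) mod m)" by (simp add: periods_def)
    from coincidence_propagates[of F x k f, OF this]
    show "m - card ?A \<le> card (bad_row f m F x) + card (bad_row f m F ((x + k) mod m))"
      by linarith
  qed
  also have "\<dots> \<le> (\<Sum>x<m. card (bad_row f m F x) + card (bad_row f m F ((x + k) mod m)))"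
    by (rule sum_mono2[OF _ sub]) auto
  also have "\<dots> = 2 * card (hom_failures f m F)"
    by (simp add: sum.distrib sum_bad_row_shift card_hom_failures)
  finally have "2 * card ?A * (m - card ?A) \<le> 4 * card (hom_failures f m F)" by simp
  moreover have "m * (m - card ?A) \<le> 2 * card ?A * (m - card ?A)"
    using assms by (intro mult_right_mono) auto
  ultimately show ?thesis by linarith
qed

text \<open>The self-improvement from one half to three quarters that makes majority periods closed
  under addition.\<close>

lemma majority_periods_large:
  assumes "16 * card (hom_failures f m F) < m ^ 2" "m < 2 * card (periods m F k)"
  shows "3 * m < 4 * card (periods m F k)"
proof -
  have "m * (4 * (m - card (periods m F k))) \<le> 16 * card (hom_failures f m F)"
    using majority_periods_gap[OF assms(2), of f] by simp
  also have "\<dots> < m * m" using assms(1) by (simp add: power2_eq_square)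
  finally have "4 * (m - card (periods m F k)) < m" by simp
  then show ?thesis using card_periods_le[of F k] by linarith
qed

text \<open>An argument \<open>u\<close> belongs to \<open>k + l\<close> as soon as \<open>u\<close>
  belongs to \<open>k\<close> and \<open>u + k\<close> belongs to \<open>l\<close>. Each condition
  fails for less than a quarter of all arguments.\<close>

lemma majority_periods_add:
  assumes small: "16 * card (hom_failures f m F) < m ^ 2"
    and "m < 2 * card (periods m F k)" "m < 2 * card (periods m F l)"
  shows "m < 2 * card (periods m F (k + l))"
proof -
  let ?N = "\<lambda>k. {u \<in> {..<m}. u \<notin> periods m F k}"
  have N: "card (?N k) + card (periods m F k) = m" for k
  proof -
    have "{..<m} = ?N k \<union> periods m F k" by (auto simp: periods_def)
    moreover have "card (?N k \<union> periods m F k) = card (?N k) + card (periods m F k)"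
      by (rule card_Un_disjoint) (auto simp: periods_def)
    ultimately show ?thesis by (metis card_lessThan)
  qed
  let ?N' = "{u \<in> {..<m}. (k + u) mod m \<notin> periods m F l}"
  have "?N (k + l) \<subseteq> ?N k \<union> ?N'"
    using m_pos by (auto simp: periods_def mod_simps add_ac)
  then have "card (?N (k + l)) \<le> card (?N k) + card ?N'"
    by (intro order_trans[OF card_mono card_Un_le]) auto
  also have "card ?N' = card (?N l)" by (rule card_shift)
  finally show ?thesis
    using N[of k] N[of l] N[of "k + l"] majority_periods_large[OF small assms(2)]
      majority_periods_large[OF small assms(3)] by linarith
qed

lemma majority_periods_mult:
  assumes "16 * card (hom_failures f m F) < m ^ 2" "m < 2 * card (periods m F k)"
  shows "m < 2 * card (periods m F (n * k))"
proof (induction n)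
  case 0
  have "periods m F 0 = {..<m}" by (auto simp: periods_def)
  then show ?case using m_pos by simp
next
  case (Suc n)
  show ?case using majority_periods_add[OF assms(1) assms(2) Suc] by simp
qed

section \<open>Collisions in subgroups of prime order\<close>

lemma periods_mod: "periods m F (k mod m) = periods m F k"
  by (auto simp: periods_def mod_simps)

text \<open>Substitute \<open>v = x + u\<close>: a collision at \<open>u\<close> says that
  \<open>y - x\<close> is a period at \<open>v\<close>. The representative
  \<open>y + (m - x)\<close> avoids truncated subtraction.\<close>

lemma card_collisions:
  assumes "x \<le> m"
  shows "card (collisions m F x y) = card (periods m F (y + (m - x)))"
proof -
  let ?P = "\<lambda>v. F v = F ((v + (y + (m - x))) mod m)"
  have "((x + u) mod m + (y + (m - x))) mod m = (y + u) mod m" for u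
  proof -
    have "((x + u) mod m + (y + (m - x))) mod m = (x + u + (y + (m - x))) mod m"
      by (simp add: mod_simps)
    also have "x + u + (y + (m - x)) = y + u + m" using assms by simp
    finally show ?thesis by simp
  qed
  then have "collisions m F x y = {u \<in> {..<m}. ?P ((x + u) mod m)}"
    by (auto simp: collisions_def)
  then have "card (collisions m F x y) = card {u \<in> {..<m}. ?P u}"
    using card_shift[of ?P x] by simp
  then show ?thesis by (simp add: periods_def)
qed

text \<open>Mod \<open>m\<close>, \<open>k\<close> generates the same subgroup as
  \<open>g = gcd k m\<close>, a proper divisor of \<open>m\<close>. For a prime \<open>p\<close>
  dividing \<open>m div g\<close>, the element \<open>m div p\<close> is a multiple of
  \<open>g\<close>, and Bezout makes \<open>g\<close> a multiple of \<open>k\<close>.\<close>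

lemma multiple_in_prime_subgroup:
  assumes "\<not> m dvd k"
  obtains p n where "prime p" "p dvd m" "[n * k = m div p] (mod m)"
proof -
  define g where "g = gcd k m"
  have g: "g dvd m" "g > 0" using m_pos by (auto simp: g_def)
  have "m div g \<noteq> 1"
  proof
    assume "m div g = 1"
    then have "g = m" using g by (metis dvd_mult_div_cancel mult.right_neutral)
    then show False using assms by (metis g_def gcd_dvd1)
  qed
  then obtain p where p: "prime p" "p dvd m div g" using prime_factor_nat by blast
  then obtain c where c: "m div g = p * c" by (elim dvdE)
  then have m: "m = g * (p * c)" using g by (metis dvd_mult_div_cancel)
  then have mp: "m div p = g * c" using p(1) by (simp add: prime_gt_0_nat mult.left_commute)
  have "k \<noteq> 0" using assms by (metis dvd_0_right)
  then obtain n where "[k * n = g] (mod m)" using cong_solve_nat[of k m] by (auto simp: g_def)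
  then have "[k * n * c = g * c] (mod m)" by (rule cong_scalar_right)
  then have "[n * c * k = m div p] (mod m)" by (simp add: mp mult_ac)
  moreover have "p dvd m" using m by simp
  ultimately show thesis using that p(1) by blast
qed

text \<open>Majority periods are closed under multiples, so along with \<open>k\<close> they contain
  the generator \<open>m div p\<close> of a subgroup of prime order and all differences of elements
  of that subgroup.\<close>

lemma majority_period_gives_collisions:
  assumes small: "16 * card (hom_failures f m F) < m ^ 2"
    and k: "m < 2 * card (periods m F k)" "\<not> m dvd k"
  shows "\<exists>p. prime p \<and> p dvd m \<and>
    (\<forall>x\<in>prime_subgroup m p. \<forall>y\<in>prime_subgroup m p. m < 2 * card (collisions m F x y))"
proof -
  obtain p n where p: "prime p" "p dvd m" and n: "[n * k = m div p] (mod m)"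
    using multiple_in_prime_subgroup[OF k(2)] .
  have "m < 2 * card (periods m F (n * k))" by (rule majority_periods_mult[OF small k(1)])
  then have base: "m < 2 * card (periods m F (m div p))"
    using n by (metis cong_def periods_mod)
  have "m < 2 * card (collisions m F x y)"
    if xy: "x \<in> prime_subgroup m p" "y \<in> prime_subgroup m p" for x y
  proof -
    obtain i j where ij: "x = i * (m div p)" "i < p" "y = j * (m div p)"
      using xy by (auto simp: prime_subgroup_def)
    have mp: "m = p * (m div p)" using p by simp
    have "x \<le> m" by (subst mp) (use ij in simp)
    \<comment> \<open>The difference \<open>j - i\<close> is represented by
      \<open>j + (p - i)\<close>, since \<open>p * (m div p) = m\<close>.\<close>
    moreover have "y + (m - x) = (j + (p - i)) * (m div p)"
      by (subst (1) mp) (simp add: ij add_mult_distrib diff_mult_distrib)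
    ultimately show ?thesis
      using majority_periods_mult[OF small base] by (simp add: card_collisions)
  qed
  then show ?thesis using p by blast
qed

text \<open>\<open>h\<close> agrees with \<open>F\<close> on the rows in \<open>G\<close> and is
  completed arbitrarily. A pair failing for \<open>h\<close> fails for \<open>F\<close> unless
  \<open>x\<close>, \<open>y\<close> or \<open>x + y\<close> lies in the complement
  \<open>N\<close>, which happens for at most \<open>3 * m * card N\<close> pairs. By Markov's
  inequality \<open>m * card N\<close> is at most four times the number of failures of
  \<open>F\<close>, and \<open>1 + 3 * 4 = 13\<close>.\<close>

lemma near_homomorphism:
  assumes \<Gamma>: "finite \<Gamma>" "card \<Gamma> = m" "\<And>x. x < m \<Longrightarrow> F x \<in> \<Gamma>"
    and small: "16 * card (hom_failures f m F) < m ^ 2"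
    and inj: "\<And>k. m < 2 * card (periods m F k) \<Longrightarrow> m dvd k"
  shows "\<exists>h. bij_betw h {..<m} \<Gamma> \<and> card (hom_failures f m h) \<le> 13 * card (hom_failures f m F)"
proof -
  \<comment> \<open>With fewer than \<open>m / 4\<close> failures in each of two rows, a coincidence
    between them propagates to more than half of all arguments.\<close>
  define G where "G = {x \<in> {..<m}. 4 * card (bad_row f m F x) < m}"
  define N where "N = {..<m} - G"
  let ?E = "card (hom_failures f m F)"
  have sub: "G \<subseteq> {..<m}" "N \<subseteq> {..<m}" "finite G" "finite N"
    by (auto simp: G_def N_def)
  have "m * card N = (\<Sum>x\<in>N. m)" by simp
  also have "\<dots> \<le> (\<Sum>x\<in>N. 4 * card (bad_row f m F x))"
    by (rule sum_mono) (auto simp: N_def G_def)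
  also have "\<dots> \<le> (\<Sum>x<m. 4 * card (bad_row f m F x))"
    by (rule sum_mono2) (use sub in auto)
  also have "\<dots> = 4 * ?E" by (simp add: card_hom_failures sum_distrib_left)
  finally have N: "m * card N \<le> 4 * ?E" .
  have "inj_on F G"
  proof (rule inj_onI)
    fix x y assume xy: "x \<in> G" "y \<in> G" "F x = F y"
    define k where "k = y + (m - x)"
    have lt: "x < m" "y < m" using xy by (auto simp: G_def)
    have "x + k = y + m" using lt by (simp add: k_def)
    then have xk: "(x + k) mod m = y" using lt by simp
    have "m < 2 * card (periods m F k)"
      using coincidence_propagates[of F x k f] xy unfolding xk by (simp add: G_def)
    then have "m dvd k" by (rule inj)
    then have "(x + k) mod m = x" using lt by (auto elim!: dvdE)
    then show "x = y" using xk by simp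
  qed
  then have bG: "bij_betw F G (F ` G)" by (rule inj_on_imp_bij_betw)
  have FG: "F ` G \<subseteq> \<Gamma>" using \<Gamma>(3) by (auto simp: G_def)
  have "card N = card (\<Gamma> - F ` G)"
    using sub FG \<Gamma> by (simp add: N_def card_Diff_subset card_image[OF \<open>inj_on F G\<close>])
  then obtain h0 where h0: "bij_betw h0 N (\<Gamma> - F ` G)"
    using \<Gamma>(1) sub finite_same_card_bij by (metis finite_Diff)
  define h where "h x = (if x \<in> G then F x else h0 x)" for x
  have "bij_betw h G (F ` G)" using bG by (rule bij_betw_cong[THEN iffD1, rotated]) (simp add: h_def)
  moreover have "bij_betw h N (\<Gamma> - F ` G)"
    using h0 by (rule bij_betw_cong[THEN iffD1, rotated]) (simp add: h_def N_def)
  ultimately have "bij_betw h (G \<union> N) (F ` G \<union> (\<Gamma> - F ` G))"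
    by (rule bij_betw_combine) auto
  moreover have "G \<union> N = {..<m}" "F ` G \<union> (\<Gamma> - F ` G) = \<Gamma>"
    using sub FG by (auto simp: N_def)
  ultimately have bij: "bij_betw h {..<m} \<Gamma>" by simp
  let ?S = "Sigma {..<m} (\<lambda>x. {y \<in> {..<m}. (x + y) mod m \<in> N})"
  have "hom_failures f m h \<subseteq> hom_failures f m F \<union> N \<times> {..<m} \<union> {..<m} \<times> N \<union> ?S"
    using m_pos by (auto simp: hom_failures_def h_def N_def split: if_splits)
  then have "card (hom_failures f m h) \<le> card (hom_failures f m F \<union> N \<times> {..<m} \<union> {..<m} \<times> N \<union> ?S)"
    by (rule card_mono[rotated]) (use sub in \<open>auto simp: finite_hom_failures\<close>)
  also have "\<dots> \<le> ?E + card (N \<times> {..<m}) + card ({..<m} \<times> N) + card ?S"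
    by (meson card_Un_le order_trans add_right_mono)
  also have "card ?S = (\<Sum>x<m. card {y \<in> {..<m}. (x + y) mod m \<in> N})" by simp
  also have "\<dots> = (\<Sum>x<m. card {y \<in> {..<m}. y \<in> N})" 
    by (intro sum.cong refl card_shift[where P = "\<lambda>z. z \<in> N"])
  also have "{y \<in> {..<m}. y \<in> N} = N" using sub by auto
  finally have "card (hom_failures f m h) \<le> ?E + 3 * (m * card N)"
    by (simp add: card_cartesian_product mult.commute)
  then show ?thesis using bij N by (intro exI[of _ h]) auto
qed

end


section \<open>Cyclic groups, distances and factorizations\<close>

text \<open>That is, \<open>h\<close> is an isomorphism from the additive group of integers mod
  \<open>m\<close>.\<close>

definition cyclic_coordinates :: "(nat \<Rightarrow> 'a) \<Rightarrow> nat \<Rightarrow> 'a set \<Rightarrow> ('a \<Rightarrow> 'a \<Rightarrow> 'a) \<Rightarrow> bool" where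
  "cyclic_coordinates h m \<Gamma> f \<longleftrightarrow> bij_betw h {..<m} \<Gamma> \<and>
     (\<forall>x<m. \<forall>y<m. f (h x) (h y) = h ((x + y) mod m))"

lemma is_cyclic_group_if_coordinates:
  assumes h: "cyclic_coordinates h m \<Gamma> g" and m: "m > 0"
  shows "is_cyclic_group \<Gamma> g"
proof -
  have bij: "bij_betw h {..<m} \<Gamma>" and
    hom: "\<And>x y. x < m \<Longrightarrow> y < m \<Longrightarrow> g (h x) (h y) = h ((x + y) mod m)"
    using h by (auto simp: cyclic_coordinates_def)
  have \<Gamma>: "\<Gamma> = h ` {..<m}" using bij by (simp add: bij_betw_def)
  let ?G = "\<lparr>carrier = \<Gamma>, monoid.mult = g, one = h 0\<rparr>"
  interpret G: group ?G
  proof (rule groupI)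
    fix x assume "x \<in> carrier ?G"
    then obtain i where i: "i < m" "x = h i" using \<Gamma> by auto
    \<comment> \<open>The inner \<open>mod m\<close> keeps the index of the inverse below
      \<open>m\<close> when \<open>i = 0\<close>.\<close>
    have "g (h ((m - i) mod m)) (h i) = h 0"
      using i m by (subst hom) (auto simp: mod_simps)
    then show "\<exists>y\<in>carrier ?G. y \<otimes>\<^bsub>?G\<^esub> x = \<one>\<^bsub>?G\<^esub>"
      using m i \<Gamma> by (intro bexI[of _ "h ((m - i) mod m)"]) auto
    show "\<one>\<^bsub>?G\<^esub> \<otimes>\<^bsub>?G\<^esub> x = x" using i m hom by simp
  next
    fix x y z assume "x \<in> carrier ?G" "y \<in> carrier ?G" "z \<in> carrier ?G"
    then obtain i j k where "i < m" "x = h i" "j < m" "y = h j" "k < m" "z = h k"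
      using \<Gamma> by auto
    then show "x \<otimes>\<^bsub>?G\<^esub> y \<otimes>\<^bsub>?G\<^esub> z = x \<otimes>\<^bsub>?G\<^esub> (y \<otimes>\<^bsub>?G\<^esub> z)"
      using m by (simp add: hom mod_simps add.assoc)
  qed (use \<Gamma> m hom in auto)
  \<comment> \<open>The generator has index \<open>1 mod m\<close> rather than \<open>1\<close>
    because of \<open>m = 1\<close>.\<close>
  have pow: "h (1 mod m) [^]\<^bsub>?G\<^esub> i = h (i mod m)" for i :: nat
  proof (induction i)
    case (Suc i)
    then show ?case using m by (simp add: hom mod_simps)
  qed (simp add: m)
  have "\<Gamma> \<subseteq> range (\<lambda>n::int. h (1 mod m) [^]\<^bsub>?G\<^esub> n)"
  proof
    fix x assume "x \<in> \<Gamma>"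
    then obtain i where "i < m" "x = h i" using \<Gamma> by auto
    then have "x = h (1 mod m) [^]\<^bsub>?G\<^esub> int i"
      by (simp only: int_pow_int pow mod_less)
    then show "x \<in> range (\<lambda>n::int. h (1 mod m) [^]\<^bsub>?G\<^esub> n)" by blast
  qed
  moreover have in\<Gamma>: "h (1 mod m) \<in> carrier ?G" using \<Gamma> m by simp
  then have "range (\<lambda>n::int. h (1 mod m) [^]\<^bsub>?G\<^esub> n) \<subseteq> \<Gamma>"
    using G.int_pow_closed[OF in\<Gamma>] by auto
  ultimately have "cyclic_group ?G"
    unfolding G.cyclic_group using in\<Gamma> by (intro bexI[of _ "h (1 mod m)"]) auto
  moreover have "finite \<Gamma>" using \<Gamma> by simp
  ultimately show ?thesis unfolding is_cyclic_group_def using G.is_group by blast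
qed

text \<open>Take the powers of a generator \<open>x\<close>. The \<open>m\<close>-th power is
  neutral, so exponents reduce mod \<open>m\<close> and the powers below \<open>m\<close> cover
  \<open>\<Gamma>\<close>; a surjection between sets of size \<open>m\<close> is injective.\<close>

lemma is_cyclic_group_coordinates:
  assumes "is_cyclic_group \<Gamma> f" "card \<Gamma> = m"
  obtains h where "cyclic_coordinates h m \<Gamma> f"
proof -
  from assms obtain e where fin: "finite \<Gamma>"
    and grp: "group \<lparr>carrier = \<Gamma>, monoid.mult = f, one = e\<rparr>"
    and cyc: "cyclic_group \<lparr>carrier = \<Gamma>, monoid.mult = f, one = e\<rparr>"
    unfolding is_cyclic_group_def by blast
  define G where "G = \<lparr>carrier = \<Gamma>, monoid.mult = f, one = e\<rparr>"
  interpret G: group G using grp by (simp add: G_def)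
  have G: "carrier G = \<Gamma>" "Coset.order G = m" "\<And>x y. x \<otimes>\<^bsub>G\<^esub> y = f x y"
    using assms by (auto simp: G_def Coset.order_def)
  have "\<one>\<^bsub>G\<^esub> \<in> \<Gamma>" using G.one_closed G(1) by simp
  then have m: "m > 0" using fin assms(2) by (auto simp: card_gt_0_iff)
  obtain x where x: "x \<in> carrier G" and ran: "carrier G = range (\<lambda>n::int. x [^]\<^bsub>G\<^esub> n)"
    using cyc G.cyclic_group unfolding G_def by blast
  have one: "x [^]\<^bsub>G\<^esub> m = \<one>\<^bsub>G\<^esub>" using G.pow_order_eq_1[OF x] G by simp
  have int_mod: "x [^]\<^bsub>G\<^esub> n = x [^]\<^bsub>G\<^esub> nat (n mod int m)" for n :: int
  proof -
    have "x [^]\<^bsub>G\<^esub> n = x [^]\<^bsub>G\<^esub> (int m * (n div int m) + n mod int m)" by simp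
    also have "\<dots> = x [^]\<^bsub>G\<^esub> (int m * (n div int m)) \<otimes>\<^bsub>G\<^esub> x [^]\<^bsub>G\<^esub> (n mod int m)"
      using x by (simp only: G.int_pow_mult)
    also have "x [^]\<^bsub>G\<^esub> (int m * (n div int m)) = (x [^]\<^bsub>G\<^esub> int m) [^]\<^bsub>G\<^esub> (n div int m)"
      using x by (simp only: G.int_pow_pow)
    also have "\<dots> = \<one>\<^bsub>G\<^esub>" using one by (simp add: int_pow_int)
    also have "x [^]\<^bsub>G\<^esub> (n mod int m) = x [^]\<^bsub>G\<^esub> nat (n mod int m)"
      using m by (metis int_pow_int int_nat_eq of_nat_0_less_iff pos_mod_sign)
    finally show ?thesis using x by simp
  qed
  have nat_mod: "x [^]\<^bsub>G\<^esub> n = x [^]\<^bsub>G\<^esub> (n mod m)" for n :: nat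
  proof -
    have "nat (int n mod int m) = n mod m" by (metis nat_int zmod_int)
    then show ?thesis using int_mod[of "int n"] by (simp only: int_pow_int)
  qed
  define h where "h i = x [^]\<^bsub>G\<^esub> i" for i :: nat
  have "h ` {..<m} = \<Gamma>"
  proof
    show "h ` {..<m} \<subseteq> \<Gamma>" using x G(1) by (auto simp: h_def)
    show "\<Gamma> \<subseteq> h ` {..<m}"
    proof
      fix y assume "y \<in> \<Gamma>"
      then obtain n :: int where "y = x [^]\<^bsub>G\<^esub> n" using ran G(1) by auto
      then have "y = h (nat (n mod int m))" using int_mod by (simp add: h_def)
      moreover have "nat (n mod int m) < m" using m by (simp add: nat_less_iff)
      ultimately show "y \<in> h ` {..<m}" by blast
    qed
  qed
  moreover from this have "inj_on h {..<m}"
    using assms(2) by (intro eq_card_imp_inj_on) auto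
  ultimately have "bij_betw h {..<m} \<Gamma>" by (simp add: bij_betw_def)
  moreover have "f (h a) (h b) = h ((a + b) mod m)" for a b
    using nat_mod[of "a + b"] x by (simp add: h_def G(3)[symmetric] G.nat_pow_mult)
  ultimately show thesis using that unfolding cyclic_coordinates_def by blast
qed

section \<open>Distances from cyclic groups\<close>

lemma table_edit_by_exchanges:
  assumes "table_on I S" "table_on I T" "D \<subseteq> I \<times> I"
  shows "table_edit S (\<lambda>ab. if ab \<in> D then T ab else S ab) (card D)"
proof -
  have "finite D" using assms by (auto simp: table_on_def intro: finite_subset)
  then show ?thesis using assms(3)
  proof (induction D rule: finite_induct)
    case empty
    then show ?case by (simp add: table_edit.start)
  next
    case (insert ab D)
    let ?T = "\<lambda>D ab. if ab \<in> D then T ab else S ab"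
    obtain a b where ab: "ab = (a, b)" "a \<in> I" "b \<in> I" using insert.prems by auto
    have "ab \<in> dom T" using ab assms(2) by (auto simp: table_on_def)
    then obtain v where v: "T ab = Some v" by auto
    have "dom (?T D) = I \<times> I"
      using assms(1,2) insert.prems by (auto simp: table_on_def dom_def split: if_splits)
    then have "table_on I (?T D)" using assms(1) by (simp add: table_on_def)
    then have "table_edit S ((?T D)((a, b) \<mapsto> v)) (card D + 1)"
      using insert ab by (intro table_edit.exchange) auto
    moreover have "(?T D)((a, b) \<mapsto> v) = ?T (insert ab D)"
      using ab v by (auto simp: fun_eq_iff)
    ultimately show ?case using insert.hyps by simp
  qed
qed

text \<open>Exchange each differing entry once; outside \<open>I \<times> I\<close> both tables are
  undefined.\<close>

lemma table_edit_distance_le: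
  assumes "table_on I S" "table_on I T"
  shows "table_edit_distance S T \<le> card {ab \<in> I \<times> I. S ab \<noteq> T ab}"
proof -
  let ?D = "{ab \<in> I \<times> I. S ab \<noteq> T ab}"
  have "(\<lambda>ab. if ab \<in> ?D then T ab else S ab) = T"
  proof
    fix ab
    show "(if ab \<in> ?D then T ab else S ab) = T ab"
    proof (cases "ab \<in> I \<times> I")
      case False
      then have "ab \<notin> dom S" "ab \<notin> dom T"
        using assms by (simp_all add: table_on_def)
      then show ?thesis by (simp add: domIff)
    qed auto
  qed
  then show ?thesis
    using table_edit_by_exchanges[OF assms, of ?D] unfolding table_edit_distance_def
    by (auto intro: Least_le)
qed

text \<open>Compare with addition mod \<open>m\<close> on \<open>{..<m}\<close>. The table of
  \<open>f\<close> read along \<open>h\<close> and the addition table share their index set and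
  differ only at failures of \<open>h\<close>.\<close>

lemma edit_far_hom_failures:
  assumes far: "edit_far is_cyclic_group \<epsilon> \<Gamma> f"
    and h: "bij_betw h {..<m} \<Gamma>" and m: "m > 0"
  shows "\<epsilon> * real m ^ 2 \<le> real (card (hom_failures f m h))"
proof -
  let ?I = "{..<m}"
  let ?g = "\<lambda>a b. (a + b) mod m"
  let ?inv = "inv_into ?I h"
  define S where "S = (\<lambda>(a, b). if a < m \<and> b < m then Some (?inv (f (h a) (h b))) else None)"
  define T where "T = (\<lambda>(a, b). if a < m \<and> b < m then Some (?g a b) else None)"
  have tab: "table_on ?I S" "table_on ?I T"
    by (auto simp: table_on_def S_def T_def dom_def split: if_splits)
  have "multiplication_table \<Gamma> f S"
    unfolding multiplication_table_def using tab h
    by (intro exI[of _ ?I] exI[of _ h]) (auto simp: S_def)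
  moreover have "multiplication_table ?I ?g T"
  proof -
    have "bij_betw id ?I ?I" by simp
    moreover have "inv_into ?I id a = a" if "a < m" for a
      using that inv_into_f_f[of id ?I a] by simp
    ultimately show ?thesis
      unfolding multiplication_table_def using tab m
      by (intro exI[of _ ?I] exI[of _ id]) (auto simp: T_def)
  qed
  ultimately have "edit_distance \<Gamma> f ?I ?g \<le> table_edit_distance S T"
    unfolding edit_distance_def by (intro Least_le) blast
  also have "\<dots> \<le> card {ab \<in> ?I \<times> ?I. S ab \<noteq> T ab}"
    by (rule table_edit_distance_le[OF tab])
  also have "\<dots> \<le> card (hom_failures f m h)"
  proof (rule card_mono[OF finite_hom_failures], safe)
    fix a b assume ab: "a < m" "b < m" "S (a, b) \<noteq> T (a, b)"
    have "?inv (h ((a + b) mod m)) = (a + b) mod m"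
      using h m by (intro inv_into_f_f) (auto simp: bij_betw_def)
    then show "(a, b) \<in> hom_failures f m h"
      using ab by (auto simp: S_def T_def hom_failures_def)
  qed
  finally have "edit_distance \<Gamma> f ?I ?g \<le> card (hom_failures f m h)" .
  moreover have "cyclic_coordinates (\<lambda>x. x) m ?I ?g"
    by (auto simp: cyclic_coordinates_def bij_betw_def)
  then have "is_cyclic_group ?I ?g" using m by (rule is_cyclic_group_if_coordinates)
  with far have "\<epsilon> * real (card \<Gamma>) ^ 2 \<le> real (edit_distance \<Gamma> f ?I ?g)"
    unfolding edit_far_def by blast
  moreover have "card \<Gamma> = m" using bij_betw_same_card[OF h] by simp
  ultimately show ?thesis by simp
qed

text \<open>Here the comparison group must live on \<open>\<Gamma>\<close>, so addition mod
  \<open>m\<close> is transported along \<open>h\<close>.\<close>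

lemma hamming_far_hom_failures:
  assumes far: "hamming_far is_cyclic_group \<epsilon> \<Gamma> f"
    and h: "bij_betw h {..<m} \<Gamma>" and m: "m > 0"
  shows "\<epsilon> * real m ^ 2 \<le> real (card (hom_failures f m h))"
proof -
  let ?inv = "inv_into {..<m} h"
  let ?g = "\<lambda>x y. h ((?inv x + ?inv y) mod m)"
  have inv: "?inv (h a) = a" if "a < m" for a
    using h that by (intro inv_into_f_f) (auto simp: bij_betw_def)
  have \<Gamma>: "\<Gamma> = h ` {..<m}" using h by (simp add: bij_betw_def)
  have "cyclic_coordinates h m \<Gamma> ?g"
    using h inv by (simp add: cyclic_coordinates_def)
  then have "is_cyclic_group \<Gamma> ?g" using m by (rule is_cyclic_group_if_coordinates)
  with far have "\<epsilon> * real (card \<Gamma>) ^ 2 \<le> real (hamming \<Gamma> f ?g)"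
    unfolding hamming_far_def by blast
  moreover have "hamming \<Gamma> f ?g \<le> card (hom_failures f m h)"
  proof -
    have "{(x, y) \<in> \<Gamma> \<times> \<Gamma>. f x y \<noteq> ?g x y} \<subseteq> (\<lambda>(a, b). (h a, h b)) ` hom_failures f m h"
    proof safe
      fix x y assume "x \<in> \<Gamma>" "y \<in> \<Gamma>" and ne: "f x y \<noteq> ?g x y"
      then obtain a b where ab: "a < m" "x = h a" "b < m" "y = h b" using \<Gamma> by auto
      then have "(a, b) \<in> hom_failures f m h" using ne inv by (simp add: hom_failures_def)
      then show "(x, y) \<in> (\<lambda>(a, b). (h a, h b)) ` hom_failures f m h" using ab by force
    qed
    then have "hamming \<Gamma> f ?g \<le> card ((\<lambda>(a, b). (h a, h b)) ` hom_failures f m h)"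
      unfolding hamming_def by (intro card_mono finite_imageI finite_hom_failures)
    also have "\<dots> \<le> card (hom_failures f m h)"
      by (rule card_image_le[OF finite_hom_failures])
    finally show ?thesis .
  qed
  moreover have "card \<Gamma> = m" using bij_betw_same_card[OF h] by simp
  ultimately show ?thesis by simp
qed

section \<open>Factorizations and generators\<close>

lemma factorization_prime_dvd_iff:
  assumes "\<forall>(p, e)\<in>set fs. prime p \<and> e > 0" "prime (p::nat)"
  shows "p dvd (\<Prod>(p, e)\<leftarrow>fs. p ^ e) \<longleftrightarrow> p \<in> fst ` set fs"
  using assms
proof (induction fs)
  case (Cons pe fs)
  obtain r e where pe: "pe = (r, e)" by fastforce
  have "p dvd r ^ e \<longleftrightarrow> p = r"
    using Cons.prems pe by (auto simp: prime_dvd_power_iff primes_dvd_imp_eq)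
  then show ?case using Cons pe by (auto simp: prime_dvd_mult_iff)
qed auto

lemma factorization_primes:
  assumes "factorization m fs" "m > 0"
  shows "fst ` set fs = prime_factors m" "length fs = card (prime_factors m)"
proof -
  have *: "\<forall>(p, e)\<in>set fs. prime p \<and> e > 0" "m = (\<Prod>(p, e)\<leftarrow>fs. p ^ e)" "distinct (map fst fs)"
    using assms by (auto simp: factorization_def)
  show 1: "fst ` set fs = prime_factors m"
  proof (rule Set.set_eqI)
    fix p
    have "prime p" if "p \<in> fst ` set fs" using that *(1) by auto
    then show "p \<in> fst ` set fs \<longleftrightarrow> p \<in> prime_factors m"
      using factorization_prime_dvd_iff[OF *(1), of p] assms(2)
      by (auto simp: in_prime_factors_iff simp flip: *(2))
  qed
  show "length fs = card (prime_factors m)"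
    using distinct_card[OF *(3)] 1 by simp
qed

text \<open>\<open>totatives m\<close> lies in \<open>{1..m}\<close> rather than
  \<open>{..<m}\<close>. For \<open>m > 1\<close> neither \<open>0\<close> nor \<open>m\<close> is
  coprime to \<open>m\<close>; for \<open>m = 1\<close> both sets have one element.\<close>

lemma card_coprime_less: "m > 0 \<Longrightarrow> card {k \<in> {..<m}. coprime k m} = totient m"
proof (cases "m = 1")
  case True
  then have "{k \<in> {..<m}. coprime k m} = {0::nat}" by auto
  then show ?thesis using True by simp
next
  case False
  assume "m > 0"
  with False have "{k \<in> {..<m}. coprime k m} = totatives m"
    by (auto simp: totatives_def intro!: Nat.gr0I le_neq_implies_less)
  then show ?thesis by (simp add: totient_def)
qed

lemma pow_val_coordinates:
  assumes "cyclic_coordinates h m \<Gamma> f" "m > 0" "k < m" "a > 0"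
  shows "pow_val f (h k) a = h ((k * a) mod m)"
  using assms(4)
proof (induction a rule: less_induct)
  case (less a)
  have hom: "f (h x) (h y) = h ((x + y) mod m)" if "x < m" "y < m" for x y
    using assms(1) that by (simp add: cyclic_coordinates_def)
  consider "a = 1" | "a > 1" "odd a" | "a > 1" "even a" using less.prems by linarith
  then show ?case
  proof cases
    case 1
    then show ?thesis using assms by (simp add: pow_val.simps)
  next
    case 2
    then have "pow_val f (h k) a = f (h k) (h ((k * (a - 1)) mod m))"
      using less.IH[of "a - 1"] by (subst pow_val.simps) simp
    also have "\<dots> = h ((k + k * (a - 1)) mod m)"
      using assms by (simp add: hom mod_simps)
    also have "k + k * (a - 1) = k * a" using 2 by (cases a) auto
    finally show ?thesis .
  next
    case 3
    then have "pow_val f (h k) a = f (h ((k * (a div 2)) mod m)) (h ((k * (a div 2)) mod m))"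
      using less.IH[of "a div 2"] by (subst pow_val.simps) simp
    also have "\<dots> = h ((k * (a div 2) + k * (a div 2)) mod m)"
      using assms by (simp add: hom mod_simps)
    also have "k * (a div 2) + k * (a div 2) = k * a" using 3 by (auto elim!: evenE)
    finally show ?thesis .
  qed
qed

lemma f_val_coordinates:
  assumes "cyclic_coordinates h m \<Gamma> f" "k < m" "a < m"
  shows "f_val f m (h k) a = h ((k * a) mod m)"
proof -
  have m: "m > 0" using assms by simp
  have hom: "f (h x) (h y) = h ((x + y) mod m)" if "x < m" "y < m" for x y
    using assms(1) that by (simp add: cyclic_coordinates_def)
  consider "m = 1" | "m \<noteq> 1" "a = 0" | "m \<noteq> 1" "a > 0" by auto
  then show ?thesis
  proof cases
    case 1
    then show ?thesis using assms by (simp add: f_val_def)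
  next
    case 2
    have "f (h k) (pow_val f (h k) (m - 1)) = h ((k + k * (m - 1)) mod m)"
      using 2 assms m by (simp add: pow_val_coordinates hom mod_simps)
    also have "k + k * (m - 1) = k * m" using m by (cases m) auto
    finally show ?thesis using 2 by (simp add: f_val_def)
  next
    case 3
    then show ?thesis using assms m by (simp add: f_val_def pow_val_coordinates)
  qed
qed

text \<open>In coordinates \<open>f_val\<close> at \<open>h k\<close> is multiplication by
  \<open>k\<close>, which is additive.\<close>

lemma hom_failures_coordinates:
  assumes h: "cyclic_coordinates h m \<Gamma> f" and k: "k < m"
  shows "hom_failures f m (f_val f m (h k)) = {}"
proof -
  have m: "m > 0" using k by simp
  have "f_val f m (h k) ((x + y) mod m) = f (f_val f m (h k) x) (f_val f m (h k) y)"
    if "x < m" "y < m" for x y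
  proof -
    have "f (h (k * x mod m)) (h (k * y mod m)) = h ((k * x mod m + k * y mod m) mod m)"
      using h m by (simp add: cyclic_coordinates_def)
    then show ?thesis
      using that m by (simp add: f_val_coordinates[OF h k] mod_simps distrib_left)
  qed
  then show ?thesis by (auto simp: hom_failures_def)
qed

text \<open>Multiplication by a unit mod \<open>m\<close> is injective, so \<open>x + u\<close> and
  \<open>y + u\<close> keep distinct images.\<close>

lemma collisions_coordinates:
  assumes h: "cyclic_coordinates h m \<Gamma> f" and k: "k < m" "coprime k m"
    and xy: "x < m" "y < m" "x \<noteq> y"
  shows "collisions m (f_val f m (h k)) x y = {}"
proof -
  have m: "m > 0" using k by simp
  have "f_val f m (h k) ((x + u) mod m) \<noteq> f_val f m (h k) ((y + u) mod m)" for u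
  proof
    assume "f_val f m (h k) ((x + u) mod m) = f_val f m (h k) ((y + u) mod m)"
    then have "h ((k * (x + u)) mod m) = h ((k * (y + u)) mod m)"
      using m by (simp add: f_val_coordinates[OF h k(1)] mod_simps)
    moreover have "inj_on h {..<m}" using h by (simp add: cyclic_coordinates_def bij_betw_def)
    ultimately have "(k * (x + u)) mod m = (k * (y + u)) mod m"
      using m by (auto dest: inj_onD)
    then have "[k * (x + u) = k * (y + u)] (mod m)" by (simp add: cong_def)
    then have "[x + u = y + u] (mod m)" using k(2) by (simp add: cong_mult_lcancel_nat)
    then have "[x = y] (mod m)" by (simp add: cong_add_rcancel_nat)
    then show False using xy by (simp add: cong_def)
  qed
  then show ?thesis by (simp add: collisions_def)
qed

lemma prime_subgroup_less:
  assumes "x \<in> prime_subgroup m p" "p dvd m" "m > 0"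
  shows "x < m"
proof -
  obtain j where j: "x = j * (m div p)" "j < p" using assms by (auto simp: prime_subgroup_def)
  have "m div p > 0" using assms by (simp add: dvd_imp_le div_greater_zero_iff dvd_pos_nat)
  then have "x < p * (m div p)" using j by simp
  then show ?thesis using assms by simp
qed


section \<open>Running time\<close>

text \<open>A worst-case bound over all runs. Every query costs a time unit, so carrying
  \<open>queries \<le> time\<close> lets one bound serve both complexities.\<close>

definition time_bound :: "bits pmf \<Rightarrow> (bits \<Rightarrow> bits \<Rightarrow> bits) \<Rightarrow> 'a prog \<Rightarrow> real \<Rightarrow> bool" where
  "time_bound O1 O2 p t \<longleftrightarrow>
     (\<forall>(v, queries, time)\<in>set_pmf (run O1 O2 p). queries \<le> time \<and> real time \<le> t)"

lemma run_bind:
  "run O1 O2 (bind_prog p h) = bind_pmf (run O1 O2 p) (\<lambda>(v, k, t). charge k t (run O1 O2 (h v)))"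
  by (induction p)
     (simp_all add: charge_def map_pmf_def bind_assoc_pmf bind_return_pmf bind_return_pmf' split_def add_ac)

lemma time_bound_mono: "time_bound O1 O2 p s \<Longrightarrow> s \<le> t \<Longrightarrow> time_bound O1 O2 p t"
  unfolding time_bound_def by fastforce

lemma time_bound_Return: "time_bound O1 O2 (Return v) 0"
  by (simp add: time_bound_def)

lemma time_bound_Tick: "time_bound O1 O2 p t \<Longrightarrow> time_bound O1 O2 (Tick n p) (real n + t)"
  unfolding time_bound_def by (fastforce simp: charge_def)

lemma time_bound_Draw: "(\<And>z. time_bound O1 O2 (k z) t) \<Longrightarrow> time_bound O1 O2 (Draw k) (1 + t)"
  unfolding time_bound_def by (fastforce simp: charge_def)

lemma time_bound_Mul: "(\<And>z. time_bound O1 O2 (k z) t) \<Longrightarrow> time_bound O1 O2 (Mul z1 z2 k) (1 + t)"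
  unfolding time_bound_def by (fastforce simp: charge_def)

lemma time_bound_Rand:
  assumes "n > 0" "\<And>a. a < n \<Longrightarrow> time_bound O1 O2 (k a) t"
  shows "time_bound O1 O2 (Rand n k) (1 + t)"
proof -
  have "set_pmf (pmf_of_set {..<n}) = {..<n}" using assms(1) by (intro set_pmf_of_set) auto
  then show ?thesis using assms(2) unfolding time_bound_def by (fastforce simp: charge_def)
qed

lemma time_bound_bind:
  assumes "time_bound O1 O2 p s" "\<And>v. time_bound O1 O2 (h v) t"
  shows "time_bound O1 O2 (bind_prog p h) (s + t)"
  using assms unfolding time_bound_def run_bind by (fastforce simp: charge_def)

text \<open>A halving lowers \<open>8 * log 2 a\<close> by 8. This pays for the halving and for an
  odd step that may follow it, each of which costs 3 ticks and one product. The parity-dependent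
  constant records whether an odd step comes first.\<close>

lemma time_bound_pow_prog:
  assumes "a > 0"
  shows "time_bound O1 O2 (pow_prog z a) ((if even a then - 1 else 3) + 8 * log 2 (real a))"
  using assms
proof (induction a rule: less_induct)
  case (less a)
  consider "a = 1" | "a > 1" "odd a" | "a > 1" "even a" using less.prems by linarith
  then show ?case
  proof cases
    case 1
    have "time_bound O1 O2 (Tick 3 (Return z)) (real 3 + 0)"
      by (intro time_bound_Tick time_bound_Return)
    then show ?thesis using 1 by (simp add: pow_prog.simps)
  next
    case 2
    have "time_bound O1 O2 (pow_prog z (a - 1)) (- 1 + 8 * log 2 (real (a - 1)))"
      using less.IH[of "a - 1"] 2 by simp
    then have "time_bound O1 O2 (Tick 3 (do { w \<leftarrow> pow_prog z (a - 1); mul z w }))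
        (real 3 + ((- 1 + 8 * log 2 (real (a - 1))) + (1 + 0)))"
      by (intro time_bound_Tick time_bound_bind time_bound_Mul time_bound_Return)
    moreover have "log 2 (real (a - 1)) \<le> log 2 (real a)" using 2 by simp
    ultimately show ?thesis using 2
      by (subst pow_prog.simps) (auto elim: time_bound_mono)
  next
    case 3
    have "time_bound O1 O2 (pow_prog z (a div 2)) (3 + 8 * log 2 (real (a div 2)))"
      by (rule time_bound_mono[OF less.IH]) (use 3 in auto)
    then have "time_bound O1 O2 (Tick 3 (do { w \<leftarrow> pow_prog z (a div 2); mul w w }))
        (real 3 + ((3 + 8 * log 2 (real (a div 2))) + (1 + 0)))"
      by (intro time_bound_Tick time_bound_bind time_bound_Mul time_bound_Return)
    moreover have "real (a div 2) = real a / 2" using 3 by (simp add: real_of_nat_div)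
    then have "log 2 (real (a div 2)) = log 2 (real a / 2)" by (rule arg_cong)
    then have "log 2 (real (a div 2)) = log 2 (real a) - 1"
      using 3 by (simp add: log_divide)
    ultimately show ?thesis using 3
      by (subst pow_prog.simps) (auto elim: time_bound_mono)
  qed
qed

text \<open>The worst case \<open>3 + 8 * log 2 m\<close> of \<open>pow_prog\<close>, plus 4 for the
  ticks of \<open>f_prog\<close> and the extra product at argument \<open>0\<close>.\<close>

definition f_time :: "nat \<Rightarrow> real" where
  "f_time m = 7 + 8 * log 2 (real m)"

lemma time_bound_pow_prog_le:
  assumes "0 < a" "a \<le> m"
  shows "time_bound O1 O2 (pow_prog z a) (f_time m - 4)"
proof (rule time_bound_mono[OF time_bound_pow_prog[OF assms(1)]])
  have "log 2 (real a) \<le> log 2 (real m)" using assms by simp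
  then show "(if even a then - 1 else 3) + 8 * log 2 (real a) \<le> f_time m - 4"
    by (simp add: f_time_def)
qed

lemma time_bound_f_prog:
  assumes "a < m"
  shows "time_bound O1 O2 (f_prog m z a) (f_time m)"
proof -
  consider "m = 1" | "m \<noteq> 1" "a = 0" | "m \<noteq> 1" "a \<noteq> 0" by blast
  then show ?thesis
  proof cases
    case 1
    have "time_bound O1 O2 (Tick 3 (Return z)) (real 3 + 0)"
      by (intro time_bound_Tick time_bound_Return)
    then show ?thesis using 1 by (auto simp: f_prog_def f_time_def elim: time_bound_mono)
  next
    case 2
    have "time_bound O1 O2 (Tick 3 (do { w \<leftarrow> pow_prog z (m - 1); mul z w }))
        (real 3 + ((f_time m - 4) + (1 + 0)))"
      using assms 2 by (intro time_bound_Tick time_bound_bind time_bound_pow_prog_le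
        time_bound_Mul time_bound_Return) auto
    then show ?thesis using 2 by (simp add: f_prog_def)
  next
    case 3
    have "time_bound O1 O2 (Tick 3 (pow_prog z a)) (real 3 + (f_time m - 4))"
      using assms 3 by (intro time_bound_Tick time_bound_pow_prog_le) auto
    then show ?thesis using 3 by (auto simp: f_prog_def elim: time_bound_mono)
  qed
qed

lemma time_bound_hom_check:
  assumes "m > 0"
  shows "time_bound O1 O2 (hom_check m z dec) (7 + 3 * f_time m)"
proof -
  have "time_bound O1 O2 (hom_check m z dec)
    (1 + (1 + (real 2 + (f_time m + (f_time m + (f_time m + (1 + (real 2 + 0))))))))"
    using assms unfolding hom_check_def bind_prog.simps
    by (intro time_bound_Rand time_bound_bind time_bound_Tick time_bound_f_prog
        time_bound_Mul time_bound_Return) auto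
  then show ?thesis by (rule time_bound_mono) simp
qed

lemma time_bound_inj_check:
  assumes "m > 0"
  shows "time_bound O1 O2 (inj_check m z xy dec) (7 + 2 * f_time m)"
proof -
  have "time_bound O1 O2 (inj_check m z xy dec)
    (1 + (real 2 + (f_time m + (real 2 + (f_time m + (real 2 + 0))))))"
    using assms unfolding inj_check_def bind_prog.simps
    by (intro time_bound_Rand time_bound_bind time_bound_Tick time_bound_f_prog
        time_bound_Return) auto
  then show ?thesis by (rule time_bound_mono) simp
qed

lemma time_bound_repeat:
  assumes "\<And>s. time_bound O1 O2 (body s) t"
  shows "time_bound O1 O2 (repeat_prog n body s) (1 + real n * (2 + t))"
proof (induction n arbitrary: s)
  case 0
  have "time_bound O1 O2 (Tick 1 (Return s)) (real 1 + 0)"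
    by (intro time_bound_Tick time_bound_Return)
  then show ?case by simp
next
  case (Suc n)
  have "time_bound O1 O2 (repeat_prog (Suc n) body s) (real 2 + (t + (1 + real n * (2 + t))))"
    unfolding repeat_prog.simps by (intro time_bound_Tick time_bound_bind assms Suc)
  then show ?case by (rule time_bound_mono) (simp add: algebra_simps)
qed

lemma time_bound_prime_checks:
  assumes "m > 0"
  shows "time_bound O1 O2 (prime_checks pick d3 m z fs dec)
    (1 + real (length fs) * (5 + real d3 * (9 + 2 * f_time m)))"
proof (induction fs arbitrary: dec)
  case Nil
  have "time_bound O1 O2 (Tick 1 (Return dec)) (real 1 + 0)"
    by (intro time_bound_Tick time_bound_Return)
  then show ?case by simp
next
  case (Cons pe fs)
  have "time_bound O1 O2 (prime_checks pick d3 m z (pe # fs) dec)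
    (real 4 + ((1 + real d3 * (2 + (7 + 2 * f_time m)))
      + (1 + real (length fs) * (5 + real d3 * (9 + 2 * f_time m)))))"
    unfolding prime_checks.simps
    by (intro time_bound_Tick time_bound_bind time_bound_repeat time_bound_inj_check assms Cons)
  then show ?case by (rule time_bound_mono) (simp add: algebra_simps)
qed

text \<open>The 7 is the fixed cost of an iteration apart from its checks, and the leading 2 is the
  final test of the loop condition. An early exit only lowers the cost.\<close>

lemma time_bound_main_loop:
  assumes "m > 0" "counter \<le> d1 + 1"
  shows "time_bound O1 O2 (main_loop pick d1 d2 d3 m fs dec counter)
    (2 + real (d1 + 1 - counter) * (7 + real d2 * (9 + 3 * f_time m)
      + real (length fs) * (5 + real d3 * (9 + 2 * f_time m))))"
  using assms(2)
proof (induction "d1 + 1 - counter" arbitrary: counter dec)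
  case 0
  have "time_bound O1 O2 (Tick 2 (Return dec)) (real 2 + 0)"
    by (intro time_bound_Tick time_bound_Return)
  then show ?case using 0 by (subst main_loop.simps) simp
next
  case (Suc k)
  let ?W = "7 + real d2 * (9 + 3 * f_time m) + real (length fs) * (5 + real d3 * (9 + 2 * f_time m))"
  have "log 2 (real m) \<ge> 0" using assms(1) by simp
  then have "f_time m \<ge> 0" by (simp add: f_time_def)
  then have W: "?W \<ge> 0" by (intro add_nonneg_nonneg mult_nonneg_nonneg) auto
  show ?case
  proof (cases "dec = FAIL")
    case True
    have le: "counter \<le> d1" using Suc.hyps(2) by simp
    have IH: "time_bound O1 O2 (main_loop pick d1 d2 d3 m fs dec' (counter + 1))
        (2 + real (d1 + 1 - (counter + 1)) * ?W)" for dec'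
      using Suc.hyps(1)[of "counter + 1"] Suc.hyps(2) le by simp
    have "time_bound O1 O2 (Tick 2 (Draw (\<lambda>z. Tick 1 (repeat_prog d2 (hom_check m z) PASS) \<bind>
          (\<lambda>dec1. prime_checks (pick counter) d3 m z fs dec1 \<bind>
            (\<lambda>dec2. Tick 1 (main_loop pick d1 d2 d3 m fs dec2 (counter + 1)))))))
      (real 2 + (1 + ((real 1 + (1 + real d2 * (2 + (7 + 3 * f_time m))))
        + ((1 + real (length fs) * (5 + real d3 * (9 + 2 * f_time m)))
        + (real 1 + (2 + real (d1 + 1 - (counter + 1)) * ?W))))))"
      by (intro time_bound_Tick time_bound_Draw time_bound_bind time_bound_repeat
          time_bound_hom_check time_bound_prime_checks IH assms(1))
    then have "time_bound O1 O2 (main_loop pick d1 d2 d3 m fs dec counter) (\<dots>)"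
      using True le by (subst main_loop.simps) simp
    moreover have "real (d1 + 1 - counter) = real (d1 + 1 - (counter + 1)) + 1" using le by simp
    ultimately show ?thesis by (elim time_bound_mono) (simp only: distrib_right, simp)
  next
    case False
    have "time_bound O1 O2 (Tick 2 (Return dec)) (real 2 + 0)"
      by (intro time_bound_Tick time_bound_Return)
    then have "time_bound O1 O2 (main_loop pick d1 d2 d3 m fs dec counter) 2"
      using False by (subst main_loop.simps) simp
    then show ?thesis by (rule time_bound_mono) (use W in simp)
  qed
qed

section \<open>Summing the costs\<close>

lemma real_nat_ceiling_le: "x \<ge> 0 \<Longrightarrow> real (nat \<lceil>x\<rceil>) \<le> x + 1"
  by linarith

text \<open>\<open>A\<close>, \<open>B\<close>, \<open>D\<close>, \<open>Q\<close> stand for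
  \<open>ln m\<close>, \<open>ln (ln m)\<close>, \<open>ln (ln (ln m))\<close>, \<open>ln q\<close>,
  further \<open>L\<close> for the cost of one value of the map and \<open>r\<close> for the number
  of primes. The factor \<open>B\<close> in the number of iterations cancels against
  \<open>r \<le> 4 * A / B\<close>.\<close>

lemma time_arithmetic:
  fixes A B D Q \<epsilon> c1 c2 c3 :: real and d1 d2 d3 r :: nat
  assumes "D \<ge> 1" "B \<ge> 1" "A \<ge> B" "Q \<ge> A" "\<epsilon> > 0" "c1 > 0" "c2 > 0" "c3 > 0"
    and d1: "real d1 \<le> c1 * B + 1" and d2: "real d2 \<le> c2 * D / \<epsilon> + 1" and d3: "real d3 \<le> c3 * D + 1"
    and r: "real r \<le> 4 * A / B" and L: "0 \<le> L" "L \<le> 19 * A"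
  shows "2 + real (d1 + 1) * (7 + real d2 * (9 + 3 * L) + real r * (5 + real d3 * (9 + 2 * L)))
    \<le> (2 + (c1 + 2) * (281 + 66 * c2 + 188 * c3)) * ((A + B / \<epsilon>) * Q * D)"
proof -
  have A: "A \<ge> 1" using assms by linarith
  \<comment> \<open>Up to constants, \<open>Y\<close> is the total for the injectivity checks and
    \<open>Z\<close> the part of the multiplicativity checks that carries
    \<open>1 / \<epsilon>\<close>. Their sum is at most the claimed \<open>X\<close> because
    \<open>A \<le> Q\<close>.\<close>
  define Y Z X where "Y = A * A * D" and "Z = B / \<epsilon> * A * D" and "X = (A + B / \<epsilon>) * Q * D"
  have YX: "Y + Z \<le> X"
  proof -
    have "Y + Z = (A + B / \<epsilon>) * A * D" by (simp add: Y_def Z_def algebra_simps)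
    also have "\<dots> \<le> X" unfolding X_def using assms A
      by (intro mult_right_mono mult_left_mono) auto
    finally show ?thesis .
  qed
  have YZ: "Y \<ge> 0" "Z \<ge> 0" using assms A by (auto simp: Y_def Z_def)
  have AD: "1 * 1 \<le> A * D" using A assms by (intro mult_mono) auto
  have "1 * 1 \<le> A * (A * D)" using A AD by (intro mult_mono) auto
  then have Y1: "1 \<le> Y" by (simp add: Y_def mult.assoc)
  have YA: "A \<le> Y" using mult_left_mono[OF AD, of A] A by (simp add: Y_def mult.assoc)
  have "B * A * 1 \<le> A * A * D" using A assms by (intro mult_mono) auto
  then have YB: "B * A \<le> Y" by (simp add: Y_def)
  have "B * 1 * 1 \<le> A * A * D" using A assms by (intro mult_mono) auto
  then have YB1: "B \<le> Y" by (simp add: Y_def)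
  have f1: "real (d1 + 1) \<le> (c1 + 2) * B"
  proof -
    have "real (d1 + 1) \<le> c1 * B + 2 * 1" using d1 by simp
    also have "\<dots> \<le> c1 * B + 2 * B" using assms by simp
    finally show ?thesis by (simp add: algebra_simps)
  qed
  \<comment> \<open>From \<open>L \<le> 19 * A\<close> and \<open>1 \<le> A\<close> follow
    \<open>9 + 3 * L \<le> 66 * A\<close> and, for the next step,
    \<open>9 + 2 * L \<le> 47 * A\<close>.\<close>
  have f2: "real d2 * (9 + 3 * L) \<le> (c2 * D / \<epsilon> + 1) * (66 * A)"
    using d2 L A assms by (intro mult_mono) auto
  have f3: "real d3 * (9 + 2 * L) \<le> (c3 + 1) * D * (47 * A)"
  proof (intro mult_mono)
    show "real d3 \<le> (c3 + 1) * D" using d3 assms(1) by (simp add: algebra_simps)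
  qed (use L A assms in auto)
  have f4: "real r * (5 + real d3 * (9 + 2 * L)) \<le> 4 * A / B * (5 + (c3 + 1) * D * (47 * A))"
    using L A assms by (intro mult_mono[OF r add_left_mono[OF f3]]) auto
  have "real (d1 + 1) * (7 + real d2 * (9 + 3 * L) + real r * (5 + real d3 * (9 + 2 * L)))
      \<le> (c1 + 2) * B * (7 + (c2 * D / \<epsilon> + 1) * (66 * A) + 4 * A / B * (5 + (c3 + 1) * D * (47 * A)))"
    using L assms A by (intro mult_mono[OF f1 add_mono[OF add_left_mono[OF f2] f4]]) auto
  also have "\<dots> = (c1 + 2) * (7 * B + 66 * c2 * Z + 66 * (B * A) + 20 * A + 188 * (c3 + 1) * Y)"
    using assms by (simp add: Y_def Z_def field_simps)
  \<comment> \<open>All terms without \<open>1 / \<epsilon>\<close> are absorbed into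
    \<open>Y\<close>; the constants then add up to \<open>7 + 66 + 20 + 188 = 281\<close>.\<close>
  also have "\<dots> \<le> (c1 + 2) * (7 * Y + 66 * c2 * Z + 66 * Y + 20 * Y + 188 * (c3 + 1) * Y)"
    using YA YB YB1 assms by (intro mult_left_mono add_mono) auto
  also have "\<dots> \<le> (c1 + 2) * ((281 + 66 * c2 + 188 * c3) * (Y + Z))"
  proof (intro mult_left_mono)
    have "0 \<le> c2 * Y" "0 \<le> c3 * Z" using assms YZ by auto
    then show "7 * Y + 66 * c2 * Z + 66 * Y + 20 * Y + 188 * (c3 + 1) * Y
        \<le> (281 + 66 * c2 + 188 * c3) * (Y + Z)"
      using YZ by (simp add: algebra_simps)
  qed (use assms in auto)
  also have "\<dots> \<le> (c1 + 2) * ((281 + 66 * c2 + 188 * c3) * X)"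
    using YX assms by (intro mult_left_mono) auto
  finally have "real (d1 + 1) * (7 + real d2 * (9 + 3 * L) + real r * (5 + real d3 * (9 + 2 * L)))
      \<le> (c1 + 2) * ((281 + 66 * c2 + 188 * c3) * X)" .
  moreover have "2 \<le> 2 * X" using Y1 YX YZ by linarith
  ultimately show ?thesis unfolding X_def[symmetric] by (simp add: algebra_simps)
qed


section \<open>The tester\<close>

lemma one_minus_power_le_exp:
  fixes a :: real
  assumes "a \<le> 1"
  shows "(1 - a) ^ n \<le> exp (- (a * real n))"
proof -
  have "(1 - a) ^ n \<le> exp (- a) ^ n"
    using assms exp_ge_add_one_self[of "- a"] by (intro power_mono) auto
  also have "\<dots> = exp (- (a * real n))" by (simp add: exp_of_nat_mult[symmetric] mult.commute)
  finally show ?thesis .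
qed

lemma lg_ge_1: "lg x \<ge> 1"
  by (simp add: lg_def)

text \<open>One copy of \<open>lg x\<close> yields \<open>1 / x\<close>; the remaining
  \<open>(C - 1) * lg x\<close> is at least \<open>C - 1\<close>.\<close>

lemma exp_neg_lg_le:
  assumes "C \<ge> 1" "x \<ge> 1"
  shows "exp (- (C * lg x)) \<le> exp (1 - C) / x"
proof -
  have "(C - 1) * 1 \<le> (C - 1) * lg x" using assms lg_ge_1 by (intro mult_left_mono) auto
  then have "C - 1 + lg x \<le> C * lg x" by (simp add: algebra_simps)
  moreover have "ln x \<le> lg x" by (simp add: lg_def)
  ultimately have "- (C * lg x) \<le> (1 - C) - ln x" by linarith
  then have "exp (- (C * lg x)) \<le> exp ((1 - C) - ln x)" by simp
  also have "\<dots> = exp (1 - C) / x" using assms by (simp add: exp_diff)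
  finally show ?thesis .
qed

text \<open>The proportion of generators is at least \<open>totient_const / lg (lg m)\<close>, so
  \<open>test_c1 * lg (lg m)\<close> draws all miss them with probability at most
  \<open>exp (- 2) \<le> 1 / 3\<close>.\<close>

definition test_c1 :: real where "test_c1 = 2 / totient_const"
text \<open>Makes \<open>exp (1 - test_exponent)\<close> equal to
  \<open>1 / (3 * (test_c1 + 2))\<close>, where \<open>(test_c1 + 2) * lg (lg m)\<close> bounds the
  number of iterations.\<close>

definition test_exponent :: real where "test_exponent = 1 + ln (3 * (test_c1 + 2))"

lemma test_c1_pos: "test_c1 > 0"
  by (simp add: test_c1_def totient_const_pos)

lemma test_exponent_ge_1: "test_exponent \<ge> 1"
  using test_c1_pos by (simp add: test_exponent_def)

text \<open>The constants are chosen so that an iteration that should fail passes with probability at most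
  \<open>exp (- test_exponent * lg (lg (lg m)))\<close>, and so that all iterations together pass with
  probability at most \<open>1 / 3\<close>.\<close>

lemma iterations_union_bound:
  assumes "l \<ge> 1" "real d1 \<le> test_c1 * l + 1"
  shows "real (d1 + 1) * exp (- (test_exponent * lg l)) \<le> 1 / 3"
proof -
  have "real (d1 + 1) \<le> (test_c1 + 2) * l" using assms by (simp add: algebra_simps)
  moreover have "exp (- (test_exponent * lg l)) \<le> exp (1 - test_exponent) / l"
    by (rule exp_neg_lg_le[OF test_exponent_ge_1 assms(1)])
  ultimately have "real (d1 + 1) * exp (- (test_exponent * lg l))
      \<le> (test_c1 + 2) * l * (exp (1 - test_exponent) / l)"
    using assms test_c1_pos by (intro mult_mono) auto
  also have "exp (1 - test_exponent) = 1 / (3 * (test_c1 + 2))"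
    using test_c1_pos by (simp add: test_exponent_def exp_minus inverse_eq_divide)
  also have "(test_c1 + 2) * l * (1 / (3 * (test_c1 + 2)) / l) = 1 / 3"
    using test_c1_pos assms by (simp add: field_simps)
  finally show ?thesis .
qed

section \<open>Completeness and soundness\<close>

context binary_oracle
begin

text \<open>At a generator \<open>f_val\<close> is an isomorphism, and valid pairs consist of
  distinct elements below \<open>m\<close>, so no check can reject.\<close>

lemma iteration_pass_generator:
  assumes h: "cyclic_coordinates h m \<Gamma> f" and k: "k < m" "coprime k m"
    and fs: "factorization m fs" and pick: "valid_pick pick"
  shows "iteration_pass (pick m c) d2 d3 fs (h k) = 1"
proof -
  have "collisions m (f_val f m (h k)) (fst (pick m c (fst pe))) (snd (pick m c (fst pe))) = {}"
    if "pe \<in> set fs" for pe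
  proof -
    have "fst pe \<in> prime_factors m"
      using factorization_primes(1)[OF fs m_pos] that by auto
    then have p: "prime (fst pe)" "fst pe dvd m" by (auto simp: in_prime_factors_iff)
    obtain x y where xy: "pick m c (fst pe) = (x, y)" by fastforce
    then have "x \<in> prime_subgroup m (fst pe)" "y \<in> prime_subgroup m (fst pe)" "x \<noteq> y"
      using pick p m_pos unfolding valid_pick_def by blast+
    then show ?thesis
      using prime_subgroup_less[OF _ p(2) m_pos] xy
      by (simp add: collisions_coordinates[OF h k])
  qed
  then have "map (\<lambda>pe. (1 - real (card (collisions m (f_val f m (h k)) (fst (pick m c (fst pe)))
      (snd (pick m c (fst pe))))) / real m) ^ d3) fs = map (\<lambda>_. 1) fs"
    by (intro map_cong refl) simp
  then show ?thesis
    unfolding iteration_pass_def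
    by (simp add: hom_failures_coordinates[OF h k(1)] map_replicate_const)
qed

lemma sum_iteration_pass_ge:
  assumes "is_cyclic_group \<Gamma> f" "factorization m fs" "valid_pick pick"
  shows "(\<Sum>\<gamma>\<in>\<Gamma>. iteration_pass (pick m c) d2 d3 fs \<gamma>) \<ge> real (totient m)"
proof -
  obtain h where h: "cyclic_coordinates h m \<Gamma> f"
    using is_cyclic_group_coordinates[OF assms(1) card] .
  have bij: "bij_betw h {..<m} \<Gamma>" using h by (simp add: cyclic_coordinates_def)
  let ?K = "{k \<in> {..<m}. coprime k m}"
  have inj: "inj_on h ?K" using bij by (auto simp: bij_betw_def inj_on_def)
  have "real (totient m) = (\<Sum>k\<in>?K. 1)"
    unfolding card_coprime_less[OF m_pos, symmetric] by simp
  also have "\<dots> = (\<Sum>k\<in>?K. iteration_pass (pick m c) d2 d3 fs (h k))"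
    by (intro sum.cong refl) (simp add: iteration_pass_generator[OF h _ _ assms(2,3)])
  also have "\<dots> = (\<Sum>\<gamma>\<in>h ` ?K. iteration_pass (pick m c) d2 d3 fs \<gamma>)"
    by (subst sum.reindex[OF inj]) (simp add: o_def)
  also have "\<dots> \<le> (\<Sum>\<gamma>\<in>\<Gamma>. iteration_pass (pick m c) d2 d3 fs \<gamma>)"
    using bij fin by (intro sum_mono2) (auto simp: bij_betw_def iteration_pass_nonneg)
  finally show ?thesis .
qed

lemma completeness:
  assumes "is_cyclic_group \<Gamma> f" "factorization m fs" "valid_pick pick"
    and d1: "real d1 \<ge> test_c1 * lg (lg (real m))"
  shows "pmf (result O1 O2 (main_loop (pick m) d1 d2 d3 m fs FAIL 0)) PASS \<ge> 2 / 3"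
proof -
  define \<theta> where "\<theta> = real (totient m) / real m"
  let ?P = "\<lambda>c. (\<Sum>\<gamma>\<in>\<Gamma>. iteration_pass (pick m c) d2 d3 fs \<gamma>) / real m"
  have P: "?P c \<ge> \<theta>" "?P c \<le> 1" for c
  proof -
    show "?P c \<ge> \<theta>" unfolding \<theta>_def
      by (intro divide_right_mono sum_iteration_pass_ge assms) auto
    have "(\<Sum>\<gamma>\<in>\<Gamma>. iteration_pass (pick m c) d2 d3 fs \<gamma>) \<le> (\<Sum>\<gamma>\<in>\<Gamma>. 1)"
      by (intro sum_mono iteration_pass_le_1)
    then show "?P c \<le> 1" using m_pos by (simp add: card)
  qed
  have "pmf (result O1 O2 (main_loop (pick m) d1 d2 d3 m fs FAIL 0)) FAIL = (\<Prod>c\<in>{0..d1}. 1 - ?P c)"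
    by (rule fail_main_loop) simp
  also have "\<dots> \<le> (\<Prod>c\<in>{0..d1}. 1 - \<theta>)"
    using P by (intro prod_mono) auto
  also have "\<dots> = (1 - \<theta>) ^ (d1 + 1)" by simp
  also have "\<dots> \<le> exp (- (\<theta> * real (d1 + 1)))"
    using P[of 0] by (intro one_minus_power_le_exp) linarith
  also have "\<dots> \<le> exp (- 2)"
  proof -
    have pos: "lg (lg (real m)) > 0" using lg_ge_1[of "lg (real m)"] by linarith
    have "2 = totient_const / lg (lg (real m)) * (test_c1 * lg (lg (real m)))"
      using pos totient_const_pos by (simp add: test_c1_def)
    also have "\<dots> \<le> \<theta> * real (d1 + 1)"
      using totient_ratio_ge[OF m_pos] d1 pos test_c1_pos totient_const_pos unfolding \<theta>_def
      by (intro mult_mono) auto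
    finally show ?thesis by simp
  qed
  also have "exp (- 2) \<le> (1 / 3 :: real)"
    using exp_ge_add_one_self[of "2::real"] by (simp add: exp_minus field_simps)
  finally show ?thesis
    using pmf_decision_sum[of "result O1 O2 (main_loop (pick m) d1 d2 d3 m fs FAIL 0)"] by linarith
qed

text \<open>The hypothesis \<open>far\<close> is a common consequence of both notions of distance.
  If the proportion of failures is at least \<open>\<epsilon> / 16\<close>, the multiplicativity
  checks reject. Otherwise a bijection with at most 13 times as many failures would contradict
  \<open>far\<close>, so \<open>near_homomorphism\<close> forces a nontrivial majority period, and
  for some prime every admissible pair collides at more than half of all \<open>u\<close>.\<close>

lemma iteration_pass_far:
  assumes far: "\<And>h. bij_betw h {..<m} \<Gamma> \<Longrightarrow> \<epsilon> * real m ^ 2 \<le> real (card (hom_failures f m h))"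
    and fs: "factorization m fs" and pick: "valid_pick pick" and \<gamma>: "\<gamma> \<in> \<Gamma>"
    and d2: "\<epsilon> / 16 * real d2 \<ge> t" and d3: "1 / 2 * real d3 \<ge> t"
  shows "iteration_pass (pick m c) d2 d3 fs \<gamma> \<le> exp (- t)"
proof -
  let ?F = "f_val f m \<gamma>"
  let ?E = "card (hom_failures f m ?F)"
  have m2: "real m ^ 2 > 0" using m_pos by simp
  \<comment> \<open>A bijection has at most \<open>m ^ 2\<close> failures, so nothing is far for
    \<open>\<epsilon> > 1\<close>. In the second case below this gives
    \<open>16 * ?E < m ^ 2\<close>.\<close>
  have \<epsilon>: "\<epsilon> \<le> 1"
  proof -
    obtain h where "bij_betw h {..<m} \<Gamma>"
      using finite_same_card_bij[of "{..<m}" \<Gamma>] fin card by auto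
    then have "\<epsilon> * real m ^ 2 \<le> real (card (hom_failures f m h))" by (rule far)
    also have "\<dots> \<le> 1 * real m ^ 2" using card_hom_failures_le[of h] m2 by (simp add: divide_le_eq)
    finally show ?thesis using m2 by (simp only: mult_le_cancel_right_pos)
  qed
  show ?thesis
  proof (cases "\<epsilon> * real m ^ 2 \<le> 16 * real ?E")
    case True
    have "iteration_pass (pick m c) d2 d3 fs \<gamma> \<le> (1 - real ?E / real m ^ 2) ^ d2"
      by (rule iteration_pass_le_hom)
    also have "\<dots> \<le> (1 - \<epsilon> / 16) ^ d2"
      using True card_hom_failures_le[of ?F] m2 by (intro power_mono) (auto simp: field_simps)
    also have "\<dots> \<le> exp (- (\<epsilon> / 16 * real d2))" using \<epsilon> by (intro one_minus_power_le_exp) simp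
    also have "\<dots> \<le> exp (- t)" using d2 by simp
    finally show ?thesis .
  next
    case False
    then have lt: "16 * real ?E < \<epsilon> * real m ^ 2" by simp
    also have "\<dots> \<le> 1 * real m ^ 2" using \<epsilon> m2 by (intro mult_right_mono) auto
    finally have "real (16 * ?E) < real (m ^ 2)" by simp
    then have small: "16 * ?E < m ^ 2" by (simp only: of_nat_less_iff)
    have "\<exists>k. m < 2 * card (periods m ?F k) \<and> \<not> m dvd k"
    proof (rule ccontr)
      assume "\<not> ?thesis"
      then obtain h where h: "bij_betw h {..<m} \<Gamma>" "card (hom_failures f m h) \<le> 13 * ?E"
        using near_homomorphism[OF m_pos fin card _ small] \<gamma> by auto
      have "\<epsilon> * real m ^ 2 \<le> real (card (hom_failures f m h))" by (rule far[OF h(1)])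
      also have "\<dots> \<le> 16 * real ?E" using h(2) by linarith
      finally show False using lt by simp
    qed
    then obtain p where p: "prime p" "p dvd m" and
      coll: "\<And>x y. x \<in> prime_subgroup m p \<Longrightarrow> y \<in> prime_subgroup m p \<Longrightarrow> m < 2 * card (collisions m ?F x y)"
      using majority_period_gives_collisions[OF m_pos small] by blast
    have "p \<in> fst ` set fs"
      using factorization_primes(1)[OF fs m_pos] p m_pos by (simp add: in_prime_factors_iff)
    then obtain pe where pe: "pe \<in> set fs" "fst pe = p" by auto
    obtain x y where xy: "pick m c p = (x, y)" by fastforce
    then have "x \<in> prime_subgroup m p" "y \<in> prime_subgroup m p"
      using pick p m_pos unfolding valid_pick_def by blast+
    then have "m < 2 * card (collisions m ?F x y)" by (rule coll)
    then have half: "1 - real (card (collisions m ?F x y)) / real m \<le> 1 - 1 / 2"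
      using m_pos by (simp add: field_simps)
    have "iteration_pass (pick m c) d2 d3 fs \<gamma> \<le> (1 - real (card (collisions m ?F x y)) / real m) ^ d3"
      using iteration_pass_le_inj[OF pe(1), of "pick m c" d2 d3 \<gamma>] pe(2) xy by simp
    also have "\<dots> \<le> (1 - 1 / 2) ^ d3"
      using half card_collisions_le[of ?F x y] by (intro power_mono) auto
    also have "\<dots> \<le> exp (- (1 / 2 * real d3))" by (intro one_minus_power_le_exp) simp
    also have "\<dots> \<le> exp (- t)" using d3 by simp
    finally show ?thesis .
  qed
qed

lemma soundness:
  assumes far: "\<And>h. bij_betw h {..<m} \<Gamma> \<Longrightarrow> \<epsilon> * real m ^ 2 \<le> real (card (hom_failures f m h))"
    and fs: "factorization m fs" and pick: "valid_pick pick"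
    and d1: "real d1 \<le> test_c1 * l + 1" and l: "l \<ge> 1"
    and d2: "\<epsilon> / 16 * real d2 \<ge> test_exponent * lg l" and d3: "1 / 2 * real d3 \<ge> test_exponent * lg l"
  shows "pmf (result O1 O2 (main_loop (pick m) d1 d2 d3 m fs FAIL 0)) FAIL \<ge> 2 / 3"
proof -
  define \<beta> where "\<beta> = exp (- (test_exponent * lg l))"
  let ?P = "\<lambda>c. (\<Sum>\<gamma>\<in>\<Gamma>. iteration_pass (pick m c) d2 d3 fs \<gamma>) / real m"
  have \<beta>: "0 \<le> \<beta>" "\<beta> \<le> 1"
    using test_exponent_ge_1 lg_ge_1[of l] by (auto simp: \<beta>_def)
  have P: "?P c \<le> \<beta>" for c
  proof -
    have "(\<Sum>\<gamma>\<in>\<Gamma>. iteration_pass (pick m c) d2 d3 fs \<gamma>) \<le> (\<Sum>\<gamma>\<in>\<Gamma>. \<beta>)"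
      unfolding \<beta>_def by (intro sum_mono iteration_pass_far[OF far fs pick _ d2 d3])
    then show ?thesis using m_pos by (simp add: card field_simps)
  qed
  have "2 / 3 \<le> 1 + real (d1 + 1) * (- \<beta>)"
    using iterations_union_bound[OF l d1] by (simp add: \<beta>_def)
  \<comment> \<open>Bernoulli's inequality serves as the union bound over the \<open>d1 + 1\<close>
    iterations.\<close>
  also have "\<dots> \<le> (1 + (- \<beta>)) ^ (d1 + 1)"
    using \<beta> by (intro Bernoulli_inequality) simp
  also have "\<dots> = (\<Prod>c\<in>{0..d1}. 1 - \<beta>)" by simp
  also have "\<dots> \<le> (\<Prod>c\<in>{0..d1}. 1 - ?P c)"
    using P \<beta> by (intro prod_mono) auto
  also have "\<dots> = pmf (result O1 O2 (main_loop (pick m) d1 d2 d3 m fs FAIL 0)) FAIL"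
    by (rule fail_main_loop[symmetric]) simp
  finally show ?thesis .
qed

end

section \<open>Both distances and the complexity bound\<close>

lemma binary_structure_oracle:
  assumes "magma \<Gamma> f" "binary_structure \<Gamma> f q O1 O2"
  obtains \<pi> where "binary_oracle \<Gamma> f O1 O2 \<pi> (card \<Gamma>)"
  using assms unfolding binary_structure_def binary_oracle_def by blast

text \<open>The predicate \<open>far\<close> abstracts from the notion of distance. The factors 16
  and 2 offset the rejection probabilities \<open>\<epsilon> / 16\<close> and \<open>1 / 2\<close>
  of a single check.\<close>

lemma cyclic_test_tester:
  fixes far :: "'a set \<Rightarrow> ('a \<Rightarrow> 'a \<Rightarrow> 'a) \<Rightarrow> bool"
  assumes \<epsilon>: "\<epsilon> > 0" and pick: "valid_pick pick"
    and far: "\<And>\<Gamma> f h m. far \<Gamma> f \<Longrightarrow> bij_betw h {..<m} \<Gamma> \<Longrightarrow> m > 0 \<Longrightarrow>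
      \<epsilon> * real m ^ 2 \<le> real (card (hom_failures f m h))"
  shows "tester is_cyclic_group far
    (cyclic_test pick test_c1 (16 * test_exponent) (2 * test_exponent) \<epsilon>)"
  unfolding tester_def
proof (intro allI impI)
  fix \<Gamma> :: "'a set" and f q O1 O2 fs
  assume mg: "magma \<Gamma> f" and bs: "binary_structure \<Gamma> f q O1 O2"
    and fs: "factorization (card \<Gamma>) fs"
  define m where "m = card \<Gamma>"
  obtain \<pi> where "binary_oracle \<Gamma> f O1 O2 \<pi> m"
    using binary_structure_oracle[OF mg bs] unfolding m_def .
  then interpret binary_oracle \<Gamma> f O1 O2 \<pi> m .
  define l where "l = lg (lg (real m))"
  define d1 d2 d3 where "d1 = nat \<lceil>test_c1 * l\<rceil>"
    and "d2 = nat \<lceil>16 * test_exponent * lg l / \<epsilon>\<rceil>" and "d3 = nat \<lceil>2 * test_exponent * lg l\<rceil>"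
  have l: "l \<ge> 1" "lg l \<ge> 1" by (simp_all add: l_def lg_ge_1)
  have run: "map_pmf fst (run O1 O2 (cyclic_test pick test_c1 (16 * test_exponent) (2 * test_exponent) \<epsilon> q (card \<Gamma>) fs))
      = result O1 O2 (main_loop (pick m) d1 d2 d3 m fs FAIL 0)"
    by (simp add: result_def cyclic_test_def d1_def d2_def d3_def l_def m_def)
  have d1: "real d1 \<ge> test_c1 * l" "real d1 \<le> test_c1 * l + 1"
    using test_c1_pos l by (auto simp: d1_def real_nat_ceiling_ge intro!: real_nat_ceiling_le)
  have "real d2 \<ge> 16 * test_exponent * lg l / \<epsilon>" by (simp add: d2_def real_nat_ceiling_ge)
  then have d2: "\<epsilon> / 16 * real d2 \<ge> test_exponent * lg l" using \<epsilon> by (simp add: field_simps)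
  have "real d3 \<ge> 2 * test_exponent * lg l" by (simp add: d3_def real_nat_ceiling_ge)
  then have d3: "1 / 2 * real d3 \<ge> test_exponent * lg l" by simp
  have fs: "factorization m fs" using fs by (simp add: m_def)
  show "(is_cyclic_group \<Gamma> f \<longrightarrow> pmf (map_pmf fst (run O1 O2
        (cyclic_test pick test_c1 (16 * test_exponent) (2 * test_exponent) \<epsilon> q (card \<Gamma>) fs))) PASS \<ge> 2 / 3) \<and>
      (far \<Gamma> f \<longrightarrow> pmf (map_pmf fst (run O1 O2
        (cyclic_test pick test_c1 (16 * test_exponent) (2 * test_exponent) \<epsilon> q (card \<Gamma>) fs))) FAIL \<ge> 2 / 3)"
    unfolding run
  proof (intro conjI impI)
    assume "is_cyclic_group \<Gamma> f"
    then show "pmf (result O1 O2 (main_loop (pick m) d1 d2 d3 m fs FAIL 0)) PASS \<ge> 2 / 3"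
      using d1(1) by (intro completeness fs pick) (auto simp: l_def)
  next
    assume "far \<Gamma> f"
    then have "\<epsilon> * real m ^ 2 \<le> real (card (hom_failures f m h))" if "bij_betw h {..<m} \<Gamma>" for h
      using far that m_pos by blast
    then show "pmf (result O1 O2 (main_loop (pick m) d1 d2 d3 m fs FAIL 0)) FAIL \<ge> 2 / 3"
      by (rule soundness[OF _ fs pick d1(2) l(1) d2 d3])
  qed
qed

text \<open>Above this threshold the iterated logarithms are all at least 1, so the cut-offs in
  \<open>lg\<close> have no effect.\<close>

lemma iterated_logs:
  assumes "m \<ge> nat \<lceil>exp (exp (exp 1 :: real))\<rceil>"
  shows "ln (ln (ln (real m))) \<ge> 1" "ln (ln (real m)) \<ge> 1" "ln (real m) \<ge> ln (ln (real m))"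
    "lg (lg (real m)) = ln (ln (real m))" "lg (lg (lg (real m))) = ln (ln (ln (real m)))"
proof -
  have e: "exp 1 \<ge> (1::real)" by simp
  have "real m \<ge> exp (exp (exp 1))" using assms by (simp add: nat_le_iff ceiling_le_iff)
  then have A: "ln (real m) \<ge> exp (exp 1)" by (metis exp_gt_zero ln_exp ln_mono)
  then have B: "ln (ln (real m)) \<ge> exp 1" by (metis exp_gt_zero ln_exp ln_mono)
  then show D: "ln (ln (ln (real m))) \<ge> 1" by (metis exp_gt_zero ln_exp ln_mono)
  show B1: "ln (ln (real m)) \<ge> 1" using B e by linarith
  have "0 < ln (real m)" using A by (meson exp_gt_zero less_le_trans)
  then show AB: "ln (real m) \<ge> ln (ln (real m))" using ln_bound by blast
  have "lg (real m) = ln (real m)" using AB B1 by (simp add: lg_def)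
  then show "lg (lg (real m)) = ln (ln (real m))" using B1 by (simp add: lg_def)
  then show "lg (lg (lg (real m))) = ln (ln (ln (real m)))" using D by (simp add: lg_def)
qed

lemma cyclic_test_time:
  fixes c1 c2 c3 \<epsilon> :: real
  assumes c: "c1 > 0" "c2 > 0" "c3 > 0" "\<epsilon> > 0"
    and m: "m \<ge> nat \<lceil>exp (exp (exp 1 :: real))\<rceil>" "m \<le> q" and fs: "factorization m fs"
  shows "time_bound O1 O2 (cyclic_test pick c1 c2 c3 \<epsilon> q m fs)
    ((2 + (c1 + 2) * (281 + 66 * c2 + 188 * c3))
      * ((ln (real m) + ln (ln (real m)) / \<epsilon>) * ln (real q) * ln (ln (ln (real m)))))"
proof -
  note logs = iterated_logs[OF m(1)]
  have "exp (exp (exp 1)) > (0::real)" by simp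
  then have m0: "m > 0" using m(1) by (metis gr0I le_zero_eq nat_0_iff ceiling_le_zero not_le)
  let ?d1 = "nat \<lceil>c1 * ln (ln (real m))\<rceil>" and ?d2 = "nat \<lceil>c2 * ln (ln (ln (real m))) / \<epsilon>\<rceil>"
    and ?d3 = "nat \<lceil>c3 * ln (ln (ln (real m)))\<rceil>"
  have "time_bound O1 O2 (cyclic_test pick c1 c2 c3 \<epsilon> q m fs)
    (2 + real (?d1 + 1 - 0) * (7 + real ?d2 * (9 + 3 * f_time m)
      + real (length fs) * (5 + real ?d3 * (9 + 2 * f_time m))))"
    unfolding cyclic_test_def logs(5) unfolding logs(4)
    by (rule time_bound_main_loop[OF m0]) simp
  moreover have "2 + real (?d1 + 1) * (7 + real ?d2 * (9 + 3 * f_time m)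
      + real (length fs) * (5 + real ?d3 * (9 + 2 * f_time m)))
    \<le> (2 + (c1 + 2) * (281 + 66 * c2 + 188 * c3))
      * ((ln (real m) + ln (ln (real m)) / \<epsilon>) * ln (real q) * ln (ln (ln (real m))))"
  proof (rule time_arithmetic)
    show "ln (real m) \<le> ln (real q)" using m m0 by simp
    show "real (length fs) \<le> 4 * ln (real m) / ln (ln (real m))"
      unfolding factorization_primes(2)[OF fs m0]
      by (rule card_prime_factors_le[OF m0]) (use logs(2) in linarith)
    have "0 \<le> log 2 (real m)" using m0 by simp
    then show "0 \<le> f_time m" by (simp add: f_time_def)
    \<comment> \<open>The bound \<open>ln 2 \<ge> 2 / 3\<close> gives
      \<open>f_time m \<le> 7 + 12 * ln m\<close>, and \<open>ln m \<ge> 1\<close>.\<close>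
    have "log 2 (real m) = ln (real m) / ln 2" by (simp add: log_def)
    also have "\<dots> \<le> ln (real m) / (2 / 3)"
      using logs ln2_ge_two_thirds by (intro divide_left_mono) auto
    finally show "f_time m \<le> 19 * ln (real m)" using logs by (simp add: f_time_def)
  qed (use logs c in \<open>auto intro!: real_nat_ceiling_le\<close>)
  ultimately show ?thesis by (auto elim: time_bound_mono)
qed

theorem theorem3:
  shows "\<exists>c1 c2 c3 K :: real. \<exists>M :: nat. c1 > 0 \<and> c2 > 0 \<and> c3 > 0 \<and>
    (\<forall>\<epsilon>::real. \<epsilon> > 0 \<longrightarrow> (\<forall>pick. valid_pick pick \<longrightarrow>
       tester is_cyclic_group (edit_far is_cyclic_group \<epsilon> :: 'a set \<Rightarrow> ('a \<Rightarrow> 'a \<Rightarrow> 'a) \<Rightarrow> bool)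
         (cyclic_test pick c1 c2 c3 \<epsilon>) \<and>
       tester is_cyclic_group (hamming_far is_cyclic_group \<epsilon> :: 'a set \<Rightarrow> ('a \<Rightarrow> 'a \<Rightarrow> 'a) \<Rightarrow> bool)
         (cyclic_test pick c1 c2 c3 \<epsilon>) \<and>
       (\<forall>(\<Gamma> :: 'a set) f q O1 O2 fs m dec queries time.
          magma \<Gamma> f \<longrightarrow> m = card \<Gamma> \<longrightarrow> m \<ge> M \<longrightarrow>
          binary_structure \<Gamma> f q O1 O2 \<longrightarrow> factorization m fs \<longrightarrow>
          (dec, queries, time) \<in> set_pmf (run O1 O2 (cyclic_test pick c1 c2 c3 \<epsilon> q m fs)) \<longrightarrow>
          real queries \<le> K * ((ln m + ln (ln m) / \<epsilon>) * ln q * ln (ln (ln m))) \<and>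
          real time \<le> K * ((ln m + ln (ln m) / \<epsilon>) * ln q * ln (ln (ln m))))))"
proof -
  define c2 c3 where "c2 = 16 * test_exponent" and "c3 = 2 * test_exponent"
  define K where "K = 2 + (test_c1 + 2) * (281 + 66 * c2 + 188 * c3)"
  have pos: "test_c1 > 0" "c2 > 0" "c3 > 0"
    using test_c1_pos test_exponent_ge_1 by (auto simp: c2_def c3_def)
  show ?thesis
  \<comment> \<open>The witnesses stay schematic here: the tester claims fix the three constants,
    and the complexity claim fixes \<open>K\<close> and the threshold \<open>M\<close>.\<close>
  proof (intro exI conjI allI impI)
    fix \<epsilon> :: real and pick assume \<epsilon>: "\<epsilon> > 0" and pick: "valid_pick pick"
    show "tester is_cyclic_group (edit_far is_cyclic_group \<epsilon> :: 'a set \<Rightarrow> ('a \<Rightarrow> 'a \<Rightarrow> 'a) \<Rightarrow> bool)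
        (cyclic_test pick test_c1 c2 c3 \<epsilon>)"
      unfolding c2_def c3_def by (intro cyclic_test_tester \<epsilon> pick edit_far_hom_failures)
    show "tester is_cyclic_group (hamming_far is_cyclic_group \<epsilon> :: 'a set \<Rightarrow> ('a \<Rightarrow> 'a \<Rightarrow> 'a) \<Rightarrow> bool)
        (cyclic_test pick test_c1 c2 c3 \<epsilon>)"
      unfolding c2_def c3_def by (intro cyclic_test_tester \<epsilon> pick hamming_far_hom_failures)
    fix \<Gamma> :: "'a set" and f q O1 O2 fs m dec queries time
    assume "magma \<Gamma> f" "m = card \<Gamma>" "m \<ge> nat \<lceil>exp (exp (exp 1 :: real))\<rceil>"
      "binary_structure \<Gamma> f q O1 O2" "factorization m fs"
      and run: "(dec, queries, time) \<in> set_pmf (run O1 O2 (cyclic_test pick test_c1 c2 c3 \<epsilon> q m fs))"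
    then have "time_bound O1 O2 (cyclic_test pick test_c1 c2 c3 \<epsilon> q m fs)
        (K * ((ln m + ln (ln m) / \<epsilon>) * ln q * ln (ln (ln m))))"
      unfolding K_def by (intro cyclic_test_time pos \<epsilon>) (auto simp: binary_structure_def)
    with run have "queries \<le> time" "real time \<le> K * ((ln m + ln (ln m) / \<epsilon>) * ln q * ln (ln (ln m)))"
      unfolding time_bound_def by auto
    then show "real queries \<le> K * ((ln m + ln (ln m) / \<epsilon>) * ln q * ln (ln (ln m)))"
      "real time \<le> K * ((ln m + ln (ln m) / \<epsilon>) * ln q * ln (ln (ln m)))"
      by linarith+
  qed (use pos in auto)
qed

end
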